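(* Let $\varphi:\mathfrak{n}\to\mathbb{C}$ be a nonsingular Lie algebra homomorphism and let $I$ be an ideal of $A=S(Z)=\mathbb{C}[x_{(1,0)}]$. Then any nontrivial (i.e. nonzero) $\mathcal{B}$-submodule of $V=M_\varphi/IM_\varphi$ contains a nonzero Whittaker vector of type $\varphi$.
   Context: Let $\mathcal{B}$ be the complex Lie algebra with basis $\{x_{(a,i)} : a\in\mathbb{Z},\ i\in\mathbb{N}\}$, $\mathbb{N}=\{0,1,2,\dots\}$, and bracket $[x_{(a,i)},x_{(b,j)}]=\big((b-1)i-(a-1)j\big)x_{(a+b,\,i+j-1)}$ (the coefficient is $0$ when $i=j=0$). Let $\mathfrak{n}=\mathrm{Span}_{\mathbb{C}}\{x_{(a,i)} : a+i>1\}$, a Lie subalgebra. Let $Z=\mathbb{C}x_{(1,0)}$ be the center of $\mathcal{B}$ and $A=S(Z)=\mathbb{C}[x_{(1,0)}]\subset\mathcal{U}(\mathcal{B})$, where $\mathcal{U}(\cdot)$ denotes the universal enveloping algebra. A Lie algebra homomorphism $\varphi:\mathfrak{n}\to\mathbb{C}$ ($\mathbb{C}$ abelian) is nonsingular if $\varphi(x_{(a,i)})\neq 0$ for all $(a,i)$ with $i\ge 0$ and $a+i=2$. For a $\mathcal{B}$-module $V$, a vector $v\in V$ is a Whittaker vector of type $\varphi$ if $xv=\varphi(x)v$ for all $x\in\mathfrak{n}$. Let $\mathbb{C}_\varphi$ be the one-dimensional $\mathfrak{n}$-module on which $x\in\mathfrak{n}$ acts by $\varphi(x)$, and let $M_\varphi=\mathcal{U}(\mathcal{B})\otimes_{\mathcal{U}(\mathfrak{n})}\mathbb{C}_\varphi$.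 *)

theory Defs
  imports Complex_Main "HOL-Algebra.Module" "HOL-Algebra.QuotRing" "HOL-Algebra.Generated_Rings"
    "HOL-Algebra.Free_Abelian_Groups"
begin

section \<open>Complex Lie algebras\<close>

definition complex_field :: "complex ring"
  where "complex_field =
    \<lparr>carrier = UNIV, monoid.mult = (*), one = 1, ring.zero = 0, add = (+)\<rparr>"

text \<open>As for the library's modules, the fields \<open>mult\<close> and \<open>one\<close> inherited from \<open>ring\<close>
  carry no meaning in the records for Lie algebras and modules below.\<close>

record 'g lie_alg = "(complex, 'g) module" +
  bracket :: "'g \<Rightarrow> 'g \<Rightarrow> 'g"

definition lie_hom :: "'g lie_alg \<Rightarrow> 'h lie_alg \<Rightarrow> ('g \<Rightarrow> 'h) set"
  where "lie_hom L K = {f \<in> carrier L \<rightarrow> carrier K.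
    (\<forall>x\<in>carrier L. \<forall>y\<in>carrier L. f (x \<oplus>\<^bsub>L\<^esub> y) = f x \<oplus>\<^bsub>K\<^esub> f y) \<and>
    (\<forall>c. \<forall>x\<in>carrier L. f (c \<odot>\<^bsub>L\<^esub> x) = c \<odot>\<^bsub>K\<^esub> f x) \<and>
    (\<forall>x\<in>carrier L. \<forall>y\<in>carrier L. f (bracket L x y) = bracket K (f x) (f y))}"

definition abelian_complex :: "complex lie_alg"
  where "abelian_complex =
    \<lparr>carrier = UNIV, monoid.mult = undefined, one = undefined, ring.zero = 0, add = (+),
     smult = (*), bracket = (\<lambda>_ _. 0)\<rparr>"


section \<open>The universal enveloping algebra\<close>

text \<open>Words form a monoid under concatenation, so that \<open>'g list \<Rightarrow>\<^sub>0 complex\<close> with the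
  convolution product of \<open>HOL-Library.Poly_Mapping\<close> is the free associative unital
  complex algebra on the set of all elements of \<open>'g\<close>.\<close>

instantiation list :: (type) monoid_add
begin
definition zero_list :: "'a list" where "zero_list = []"
definition plus_list :: "'a list \<Rightarrow> 'a list \<Rightarrow> 'a list" where "plus_list = (@)"
instance by standard (simp_all add: zero_list_def plus_list_def)
end

definition free_algebra :: "'g set \<Rightarrow> ('g list \<Rightarrow>\<^sub>0 complex) ring"
  where "free_algebra X =
    \<lparr>carrier = {p. \<forall>w\<in>Poly_Mapping.keys p. set w \<subseteq> X},
     monoid.mult = (*), one = 1, ring.zero = 0, add = (+)\<rparr>"

definition gen :: "'g \<Rightarrow> 'g list \<Rightarrow>\<^sub>0 complex"
  where "gen x = Poly_Mapping.single [x] 1"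

definition const :: "complex \<Rightarrow> 'g list \<Rightarrow>\<^sub>0 complex"
  where "const c = Poly_Mapping.single [] c"

text \<open>The generators are all elements of \<open>L\<close>, not those of a basis. The first two families of
  relations make \<open>gen\<close> linear, so they cut the free algebra down to the tensor algebra of \<open>L\<close>.\<close>

definition uea_rel :: "'g lie_alg \<Rightarrow> ('g list \<Rightarrow>\<^sub>0 complex) set"
  where "uea_rel L =
    {gen (x \<oplus>\<^bsub>L\<^esub> y) - (gen x + gen y) | x y. x \<in> carrier L \<and> y \<in> carrier L} \<union>
    {gen (c \<odot>\<^bsub>L\<^esub> x) - const c * gen x | c x. x \<in> carrier L} \<union>
    {gen x * gen y - gen y * gen x - gen (bracket L x y) | x y. x \<in> carrier L \<and> y \<in> carrier L}"

definition uea_ideal :: "'g lie_alg \<Rightarrow> ('g list \<Rightarrow>\<^sub>0 complex) set"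
  where "uea_ideal L = Idl\<^bsub>free_algebra (carrier L)\<^esub> (uea_rel L)"

definition uea :: "'g lie_alg \<Rightarrow> ('g list \<Rightarrow>\<^sub>0 complex) set ring"
  where "uea L = free_algebra (carrier L) Quot uea_ideal L"

definition uea_class :: "'g lie_alg \<Rightarrow> ('g list \<Rightarrow>\<^sub>0 complex) \<Rightarrow> ('g list \<Rightarrow>\<^sub>0 complex) set"
  where "uea_class L p = uea_ideal L +>\<^bsub>free_algebra (carrier L)\<^esub> p"

definition uea_of :: "'g lie_alg \<Rightarrow> 'g \<Rightarrow> ('g list \<Rightarrow>\<^sub>0 complex) set"
  where "uea_of L x = uea_class L (gen x)"

definition uea_const :: "'g lie_alg \<Rightarrow> complex \<Rightarrow> ('g list \<Rightarrow>\<^sub>0 complex) set"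
  where "uea_const L c = uea_class L (const c)"

text \<open>For a Lie subalgebra \<open>K\<close> of \<open>L\<close>, the homomorphism from \<open>U(K)\<close> to \<open>U(L)\<close> induced by the
  inclusion: it enlarges the coset of \<open>p\<close> modulo the ideal of \<open>K\<close> to the one modulo that of \<open>L\<close>.\<close>

definition uea_incl :: "'g lie_alg \<Rightarrow> ('g list \<Rightarrow>\<^sub>0 complex) set \<Rightarrow> ('g list \<Rightarrow>\<^sub>0 complex) set"
  where "uea_incl L u = uea_ideal L <+>\<^bsub>free_algebra (carrier L)\<^esub> u"

text \<open>The algebra homomorphism from \<open>U(K)\<close> to the complex numbers extending a Lie algebra
  homomorphism \<open>\<phi>\<close>; evaluation at \<open>\<phi>\<close> is constant on each coset.\<close>

definition free_eval :: "('g \<Rightarrow> complex) \<Rightarrow> ('g list \<Rightarrow>\<^sub>0 complex) \<Rightarrow> complex"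
  where "free_eval \<phi> p =
    (\<Sum>w\<in>Poly_Mapping.keys p. Poly_Mapping.lookup p w * prod_list (map \<phi> w))"

definition uea_char :: "('g \<Rightarrow> complex) \<Rightarrow> ('g list \<Rightarrow>\<^sub>0 complex) set \<Rightarrow> complex"
  where "uea_char \<phi> u = the_elem (free_eval \<phi> ` u)"

definition char_module :: "('g \<Rightarrow> complex) \<Rightarrow> (('g list \<Rightarrow>\<^sub>0 complex) set, complex) module"
  where "char_module \<phi> =
    \<lparr>carrier = UNIV, monoid.mult = undefined, one = undefined, ring.zero = 0, add = (+),
     smult = (\<lambda>u z. uea_char \<phi> u * z)\<rparr>"


section \<open>Modules over a not necessarily commutative ring\<close>

text \<open>The locale \<open>module\<close> of the library is restricted to commutative rings, but its record type
  serves for left modules over any ring.\<close>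

definition quot_module :: "('r, 'a) module \<Rightarrow> 'a set \<Rightarrow> ('r, 'a set) module"
  where "quot_module M N =
    \<lparr>carrier = a_rcosets\<^bsub>M\<^esub> N, monoid.mult = undefined, one = undefined, ring.zero = N, add = set_add M,
     smult = (\<lambda>r C. \<Union>x\<in>C. N +>\<^bsub>M\<^esub> (r \<odot>\<^bsub>M\<^esub> x))\<rparr>"

text \<open>The additive subgroup generated by the products \<open>a x\<close>. It is a submodule when \<open>I\<close> is a left ideal
  or consists of central elements; the latter is the case for \<open>I\<close> inside \<open>A\<close> below.\<close>

definition ideal_times :: "'r set \<Rightarrow> ('r, 'a) module \<Rightarrow> 'a set"
  where "ideal_times I M = generate (add_monoid M) {a \<odot>\<^bsub>M\<^esub> x | a x. a \<in> I \<and> x \<in> carrier M}"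

text \<open>For a ring homomorphism \<open>f\<close> from \<open>R\<close> to \<open>S\<close> and a left \<open>R\<close>-module \<open>Q\<close>, the left
  \<open>S\<close>-module obtained as the tensor product of \<open>S\<close> and \<open>Q\<close> over \<open>R\<close>, where \<open>r\<close> acts on \<open>S\<close>
  from the right as multiplication by \<open>f r\<close>.\<close>

definition tensor_free :: "('s, 'm) ring_scheme \<Rightarrow> ('r, 'q) module \<Rightarrow> ('s \<times> 'q \<Rightarrow>\<^sub>0 int) monoid"
  where "tensor_free S Q = free_Abelian_group (carrier S \<times> carrier Q)"

definition tensor_rel :: "('r, 'n) ring_scheme \<Rightarrow> ('s, 'm) ring_scheme \<Rightarrow> ('r \<Rightarrow> 's) \<Rightarrow>
    ('r, 'q) module \<Rightarrow> ('s \<times> 'q \<Rightarrow>\<^sub>0 int) set"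
  where "tensor_rel R S f Q =
    {frag_of (s \<oplus>\<^bsub>S\<^esub> t, q) - (frag_of (s, q) + frag_of (t, q)) | s t q.
       s \<in> carrier S \<and> t \<in> carrier S \<and> q \<in> carrier Q} \<union>
    {frag_of (s, q \<oplus>\<^bsub>Q\<^esub> p) - (frag_of (s, q) + frag_of (s, p)) | s q p.
       s \<in> carrier S \<and> q \<in> carrier Q \<and> p \<in> carrier Q} \<union>
    {frag_of (s \<otimes>\<^bsub>S\<^esub> f r, q) - frag_of (s, r \<odot>\<^bsub>Q\<^esub> q) | s r q.
       s \<in> carrier S \<and> r \<in> carrier R \<and> q \<in> carrier Q}"

definition tensor_null :: "('r, 'n) ring_scheme \<Rightarrow> ('s, 'm) ring_scheme \<Rightarrow> ('r \<Rightarrow> 's) \<Rightarrow>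
    ('r, 'q) module \<Rightarrow> ('s \<times> 'q \<Rightarrow>\<^sub>0 int) set"
  where "tensor_null R S f Q = generate (tensor_free S Q) (tensor_rel R S f Q)"

definition induced_module :: "('r, 'n) ring_scheme \<Rightarrow> ('s, 'm) ring_scheme \<Rightarrow> ('r \<Rightarrow> 's) \<Rightarrow>
    ('r, 'q) module \<Rightarrow> ('s, ('s \<times> 'q \<Rightarrow>\<^sub>0 int) set) module"
  where "induced_module R S f Q =
    (let F = tensor_free S Q; N = tensor_null R S f Q; T = F Mod N in
     \<lparr>carrier = carrier T, monoid.mult = undefined, one = undefined, ring.zero = one T, add = monoid.mult T,
      smult = (\<lambda>s C. \<Union>c\<in>C. N #>\<^bsub>F\<^esub> frag_extend (\<lambda>(t, q). frag_of (s \<otimes>\<^bsub>S\<^esub> t, q)) c)\<rparr>)"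


section \<open>Lie algebra modules and Whittaker vectors\<close>

record ('g, 'v) lie_mod = "(complex, 'v) module" +
  act :: "'g \<Rightarrow> 'v \<Rightarrow> 'v"

definition lie_mod_of_uea ::
    "'g lie_alg \<Rightarrow> (('g list \<Rightarrow>\<^sub>0 complex) set, 'v) module \<Rightarrow> ('g, 'v) lie_mod"
  where "lie_mod_of_uea L M =
    \<lparr>carrier = carrier M, monoid.mult = undefined, one = undefined,
     ring.zero = \<zero>\<^bsub>M\<^esub>, add = add M,
     smult = (\<lambda>c v. uea_const L c \<odot>\<^bsub>M\<^esub> v),
     act = (\<lambda>x v. uea_of L x \<odot>\<^bsub>M\<^esub> v)\<rparr>"

definition lie_submodule :: "'g lie_alg \<Rightarrow> 'v set \<Rightarrow> ('g, 'v) lie_mod \<Rightarrow> bool"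
  where "lie_submodule L W V \<longleftrightarrow>
    submodule W complex_field V \<and> (\<forall>x\<in>carrier L. \<forall>w\<in>W. act V x w \<in> W)"

definition whittaker_vector ::
    "'g lie_alg \<Rightarrow> ('g \<Rightarrow> complex) \<Rightarrow> ('g, 'v) lie_mod \<Rightarrow> 'v \<Rightarrow> bool"
  where "whittaker_vector N \<phi> V v \<longleftrightarrow>
    v \<in> carrier V \<and> (\<forall>x\<in>carrier N. act V x v = \<phi> x \<odot>\<^bsub>V\<^esub> v)"


section \<open>The Lie algebra \<open>\<B>\<close> and the modules \<open>M\<^sub>\<phi>\<close>\<close>

type_synonym bvec = "int \<times> nat \<Rightarrow>\<^sub>0 complex"

type_synonym uB = "(bvec list \<Rightarrow>\<^sub>0 complex) set"

definition bscale :: "complex \<Rightarrow> bvec \<Rightarrow> bvec"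
  where "bscale c f = Poly_Mapping.map ((*) c) f"

definition xB :: "int \<Rightarrow> nat \<Rightarrow> bvec"
  where "xB a i = Poly_Mapping.single (a, i) 1"

text \<open>The truncated difference \<open>i + j - 1\<close> is harmless: for \<open>i = j = 0\<close> the coefficient is 0.\<close>

definition basis_bracket :: "int \<times> nat \<Rightarrow> int \<times> nat \<Rightarrow> bvec"
  where "basis_bracket = (\<lambda>(a, i) (b, j).
    bscale (of_int ((b - 1) * int i - (a - 1) * int j)) (xB (a + b) (i + j - 1)))"

definition bbracket :: "bvec \<Rightarrow> bvec \<Rightarrow> bvec"
  where "bbracket f g =
    (\<Sum>k\<in>Poly_Mapping.keys f. \<Sum>l\<in>Poly_Mapping.keys g.
      bscale (Poly_Mapping.lookup f k * Poly_Mapping.lookup g l) (basis_bracket k l))"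

definition algB :: "bvec lie_alg"
  where "algB =
    \<lparr>carrier = UNIV, monoid.mult = undefined, one = undefined, ring.zero = 0, add = (+),
     smult = bscale, bracket = bbracket\<rparr>"

definition algN :: "bvec lie_alg"
  where "algN =
    algB\<lparr>carrier := Modules.module.span bscale {xB a i | a i. a + int i > 1}\<rparr>"

definition nonsingular :: "(bvec \<Rightarrow> complex) \<Rightarrow> bool"
  where "nonsingular \<phi> \<longleftrightarrow> (\<forall>a i. a + int i = 2 \<longrightarrow> \<phi> (xB a i) \<noteq> 0)"

text \<open>\<open>A = \<complex>[x\<^sub>(\<^sub>1\<^sub>,\<^sub>0\<^sub>)]\<close> as a subring of \<open>U(\<B>)\<close>.\<close>

definition ringA :: "uB ring"
  where "ringA = (uea algB)
    \<lparr>carrier := generate_ring (uea algB) (range (uea_const algB) \<union> {uea_of algB (xB 1 0)})\<rparr>"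

definition modM :: "(bvec \<Rightarrow> complex) \<Rightarrow> (uB, (uB \<times> complex \<Rightarrow>\<^sub>0 int) set) module"
  where "modM \<phi> = induced_module (uea algN) (uea algB) (uea_incl algB) (char_module \<phi>)"

definition modV ::
    "(bvec \<Rightarrow> complex) \<Rightarrow> uB set \<Rightarrow> (bvec, (uB \<times> complex \<Rightarrow>\<^sub>0 int) set set) lie_mod"
  where "modV \<phi> I = lie_mod_of_uea algB (quot_module (modM \<phi>) (ideal_times I (modM \<phi>)))"

end

theory Submission
  imports Defs
begin

text \<open>Grade \<open>\<B>\<close> by \<open>deg x\<^sub>(\<^sub>a\<^sub>,\<^sub>i\<^sub>) = 1 - (a + i)\<close>, so that \<open>\<nn>\<close> is the part of negative degree. The
  Whittaker generator \<open>w\<close> spans \<open>M\<^sub>\<phi>\<close> under words \<open>u\<close> in basis elements of degree at least 0, and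
  words are ordered lexicographically by their total degree and their number of letters of degree 0.
  For a basis element \<open>x\<close> of \<open>\<nn>\<close>, moving \<open>x\<close> to the right through \<open>u\<close> shows that
  \<open>(x - \<phi>(x)) u w\<close> is a combination of strictly smaller words: a commutator with a letter lowers the
  total degree or, when it lies in \<open>\<nn>\<close> and the letter has degree 0, removes that letter. As this
  order is well-founded, a nonzero vector of minimal order in a submodule is killed by all
  \<open>x - \<phi>(x)\<close>. No basis theorem is required, since minimality only refers to a spanning set.

  The argument takes place in the free algebra, modulo the annihilator of the image of \<open>w\<close>.\<close>

section \<open>The free algebra\<close>

lemma const_mult_single: "const c * Poly_Mapping.single w d = Poly_Mapping.single w (c * d)"
  by (simp add: const_def mult_single plus_list_def)

lemma gen_mult_single: "gen x * Poly_Mapping.single w d = Poly_Mapping.single (x # w) d"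
  by (simp add: gen_def mult_single plus_list_def)

lemma one_eq_single_Nil: "(1 :: 'g list \<Rightarrow>\<^sub>0 complex) = Poly_Mapping.single [] 1"
  by (metis single_one zero_list_def)

lemma const_1: "const 1 = 1"
  by (simp add: const_def one_eq_single_Nil)

lemma const_0: "const 0 = 0"
  by (simp add: const_def)

lemma const_add: "const (c + d) = const c + const d"
  by (simp add: const_def single_add)

lemma const_mult: "const (c * d) = const c * const d"
  by (simp add: const_def mult_single plus_list_def)

lemma const_uminus: "const (- c) = - const c"
  by (simp add: const_def single_uminus)

text \<open>Freshness of \<open>k\<close> and \<open>c \<noteq> 0\<close> exclude cancellation: the
  keys of the sum are \<open>k\<close> and those of \<open>f\<close>, so a condition on the keys of
  the sum passes to \<open>f\<close>.\<close>

lemma poly_mapping_add_single_induct [case_names zero add]: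
  assumes "P 0" and "\<And>k c f. P f \<Longrightarrow> k \<notin> Poly_Mapping.keys f \<Longrightarrow> c \<noteq> 0 \<Longrightarrow> P (Poly_Mapping.single k c + f)"
  shows "P (f :: 'k \<Rightarrow>\<^sub>0 'c::monoid_add)"
proof (induction f rule: update_induct)
  case const
  show ?case by (fact assms(1))
next
  case (update f a b)
  have "Poly_Mapping.update a b f = Poly_Mapping.single a b + f"
    using update(1) by (intro poly_mapping_eqI) (auto simp: lookup_update lookup_add lookup_single when_def in_keys_iff)
  with assms(2)[OF update(3,1,2)] show ?case by simp
qed

text \<open>Scalars sit on the empty word, the unit of concatenation, and therefore commute with
  every word.\<close>

lemma const_commute: "const c * p = p * const c"
proof (induction p rule: poly_mapping_add_single_induct)
  case (add w d p)
  have "const c * Poly_Mapping.single w d = Poly_Mapping.single w d * const c"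
    by (simp add: const_def mult_single plus_list_def mult.commute)
  with add.IH show ?case by (simp add: algebra_simps)
qed simp

lemma const_left_commute: "const c * (p * q) = p * (const c * q)"
  by (simp only: mult.assoc[symmetric] const_commute[of c p])

lemma ring_free_algebra: "ring (free_algebra X)"
proof (rule ringI)
  show "abelian_group (free_algebra X)"
  proof (rule abelian_groupI)
    fix p assume "p \<in> carrier (free_algebra X)"
    then show "\<exists>q\<in>carrier (free_algebra X). q \<oplus>\<^bsub>free_algebra X\<^esub> p = \<zero>\<^bsub>free_algebra X\<^esub>"
      by (intro bexI[of _ "- p"]) (auto simp: free_algebra_def)
  qed (auto simp: free_algebra_def dest!: subsetD[OF keys_add])
  show "monoid (free_algebra X)"
    by (rule monoidI)
      (fastforce simp: free_algebra_def mult.assoc zero_list_def plus_list_def dest!: subsetD[OF keys_mult])+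
qed (auto simp: free_algebra_def distrib_left distrib_right)

lemma carrier_free_algebra: "p \<in> carrier (free_algebra X) \<longleftrightarrow> (\<forall>w\<in>Poly_Mapping.keys p. set w \<subseteq> X)"
  by (simp add: free_algebra_def)

lemma carrier_free_algebra_UNIV [simp]: "carrier (free_algebra UNIV) = UNIV"
  by (simp add: free_algebra_def)

lemma free_algebra_simps [simp]:
  "p \<oplus>\<^bsub>free_algebra X\<^esub> q = p + q" "p \<otimes>\<^bsub>free_algebra X\<^esub> q = p * q"
  "\<zero>\<^bsub>free_algebra X\<^esub> = 0" "\<one>\<^bsub>free_algebra X\<^esub> = 1"
  by (simp_all add: free_algebra_def)

lemma a_inv_free_algebra [simp]:
  assumes "p \<in> carrier (free_algebra X)" shows "\<ominus>\<^bsub>free_algebra X\<^esub> p = - p"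
proof -
  interpret ring "free_algebra X" by (rule ring_free_algebra)
  have "- p \<in> carrier (free_algebra X)" using assms by (simp add: carrier_free_algebra)
  with assms show ?thesis by (intro minus_equality) auto
qed

lemma free_algebra_closed [simp]:
  "p \<in> carrier (free_algebra X) \<Longrightarrow> q \<in> carrier (free_algebra X) \<Longrightarrow> p + q \<in> carrier (free_algebra X)"
  "p \<in> carrier (free_algebra X) \<Longrightarrow> q \<in> carrier (free_algebra X) \<Longrightarrow> p - q \<in> carrier (free_algebra X)"
  "p \<in> carrier (free_algebra X) \<Longrightarrow> q \<in> carrier (free_algebra X) \<Longrightarrow> p * q \<in> carrier (free_algebra X)"
  "const c \<in> carrier (free_algebra X)"
  "x \<in> X \<Longrightarrow> gen x \<in> carrier (free_algebra X)"
proof -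
  interpret ring "free_algebra X" by (rule ring_free_algebra)
  show "p \<in> carrier (free_algebra X) \<Longrightarrow> q \<in> carrier (free_algebra X) \<Longrightarrow> p + q \<in> carrier (free_algebra X)"
    using a_closed[of p q] by simp
  show "p \<in> carrier (free_algebra X) \<Longrightarrow> q \<in> carrier (free_algebra X) \<Longrightarrow> p - q \<in> carrier (free_algebra X)"
    using minus_closed[of p q] by (simp add: a_minus_def)
  show "p \<in> carrier (free_algebra X) \<Longrightarrow> q \<in> carrier (free_algebra X) \<Longrightarrow> p * q \<in> carrier (free_algebra X)"
    using m_closed[of p q] by simp
qed (auto simp: carrier_free_algebra const_def gen_def)

section \<open>Evaluation of the free algebra at a function on the generators\<close>

lemma free_eval_altdef:
  assumes "finite A" "Poly_Mapping.keys p \<subseteq> A"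
  shows "free_eval \<phi> p = (\<Sum>w\<in>A. Poly_Mapping.lookup p w * prod_list (map \<phi> w))"
  unfolding free_eval_def using assms by (intro sum.mono_neutral_left) (auto simp: in_keys_iff)

lemma free_eval_0 [simp]: "free_eval \<phi> 0 = 0"
  by (simp add: free_eval_def)

lemma free_eval_add: "free_eval \<phi> (p + q) = free_eval \<phi> p + free_eval \<phi> q"
proof -
  let ?A = "Poly_Mapping.keys p \<union> Poly_Mapping.keys q"
  have "Poly_Mapping.keys (p + q) \<subseteq> ?A" by (rule keys_add)
  then show ?thesis
    by (simp add: free_eval_altdef[of ?A] lookup_add distrib_right sum.distrib)
qed

lemma free_eval_uminus: "free_eval \<phi> (- p) = - free_eval \<phi> p"
  using free_eval_add[of \<phi> p "- p"] by (simp add: eq_neg_iff_add_eq_0 add.commute)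

lemma free_eval_diff: "free_eval \<phi> (p - q) = free_eval \<phi> p - free_eval \<phi> q"
  using free_eval_add[of \<phi> p "- q"] by (simp add: free_eval_uminus)

lemma free_eval_single [simp]: "free_eval \<phi> (Poly_Mapping.single w c) = c * prod_list (map \<phi> w)"
  by (simp add: free_eval_def)

text \<open>Expanding both factors into monomials leaves the rule that \<open>prod_list\<close>
  turns concatenation into multiplication.\<close>

lemma free_eval_mult: "free_eval \<phi> (p * q) = free_eval \<phi> p * free_eval \<phi> q"
proof (induction p rule: poly_mapping_add_single_induct)
  case (add v c p)
  have "free_eval \<phi> (Poly_Mapping.single v c * q) = free_eval \<phi> (Poly_Mapping.single v c) * free_eval \<phi> q"
    by (induction q rule: poly_mapping_add_single_induct)
      (simp_all add: distrib_left free_eval_add mult_single plus_list_def)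
  with add.IH show ?case by (simp add: distrib_right free_eval_add)
qed simp

lemma free_eval_gen [simp]: "free_eval \<phi> (gen x) = \<phi> x"
  by (simp add: gen_def)

lemma free_eval_const [simp]: "free_eval \<phi> (const c) = c"
  by (simp add: const_def)

text \<open>Negation is multiplication by \<open>const (-1)\<close>, so closure under inverses is a
  case of absorption.\<close>

lemma free_algebra_idealI:
  assumes "A \<subseteq> carrier (free_algebra X)" "0 \<in> A"
    and "\<And>p q. p \<in> A \<Longrightarrow> q \<in> A \<Longrightarrow> p + q \<in> A"
    and l: "\<And>p q. p \<in> A \<Longrightarrow> q \<in> carrier (free_algebra X) \<Longrightarrow> q * p \<in> A"
    and "\<And>p q. p \<in> A \<Longrightarrow> q \<in> carrier (free_algebra X) \<Longrightarrow> p * q \<in> A"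
  shows "ideal A (free_algebra X)"
proof (rule idealI)
  interpret ring "free_algebra X" by (rule ring_free_algebra)
  show "subgroup A (add_monoid (free_algebra X))"
  proof (rule group.subgroupI[OF a_group])
    fix p assume p: "p \<in> A"
    then have "p \<in> carrier (free_algebra X)" using assms(1) by blast
    then have "inv\<^bsub>add_monoid (free_algebra X)\<^esub> p = - p"
      using a_inv_free_algebra[of p X] by (simp add: a_inv_def)
    then show "inv\<^bsub>add_monoid (free_algebra X)\<^esub> p \<in> A"
      using l[OF p free_algebra_closed(4)[of "-1"]] by (simp add: const_uminus const_1)
  qed (use assms(1-3) in auto)
qed (use l assms(5) ring_free_algebra in auto)

text \<open>Scalars and generators generate the free algebra as a ring. This serves for properties
  that respect sums and products, such as commuting with \<open>xB 1 0\<close> modulo an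
  ideal.\<close>

lemma free_algebra_induct [consumes 1, case_names const gen add mult]:
  assumes "p \<in> carrier (free_algebra X)"
    and const: "\<And>c. P (const c)" and gen: "\<And>x. x \<in> X \<Longrightarrow> P (gen x)"
    and add: "\<And>p q. P p \<Longrightarrow> P q \<Longrightarrow> P (p + q)"
    and mult: "\<And>p q. P p \<Longrightarrow> P q \<Longrightarrow> P (p * q)"
  shows "P p"
  using assms(1)
proof (induction p rule: poly_mapping_add_single_induct)
  case zero
  show ?case using const[of 0] by (simp add: const_0)
next
  case (add w c p)
  have "Poly_Mapping.keys (Poly_Mapping.single w c + p) = insert w (Poly_Mapping.keys p)"
    using add.hyps by (auto simp: in_keys_iff lookup_add lookup_single when_def split: if_splits)
  with add.prems have w: "set w \<subseteq> X" and p: "p \<in> carrier (free_algebra X)"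
    by (auto simp: carrier_free_algebra)
  have "P (Poly_Mapping.single w 1)"
    using w
  proof (induction w)
    case Nil
    show ?case using const[of 1] by (simp add: const_def)
  next
    case (Cons x w)
    then have "P (gen x * Poly_Mapping.single w 1)" by (intro mult gen) auto
    then show ?case by (simp only: gen_mult_single)
  qed
  then have "P (Poly_Mapping.single w c)"
    using mult[OF const[of c]] const_mult_single[of c w 1] by (metis mult_1_right)
  then show ?case using add.IH[OF p] assms(4) by blast
qed

section \<open>The universal enveloping algebra\<close>

lemma uea_rel_smultI: "x \<in> carrier L \<Longrightarrow> gen (c \<odot>\<^bsub>L\<^esub> x) - const c * gen x \<in> uea_rel L"
  unfolding uea_rel_def by blast

lemma uea_rel_bracketI: "x \<in> carrier L \<Longrightarrow> y \<in> carrier L \<Longrightarrow>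
    gen x * gen y - gen y * gen x - gen (bracket L x y) \<in> uea_rel L"
  unfolding uea_rel_def by blast

text \<open>Closure places the relations in the free algebra on the carrier, so that they generate
  an ideal there. The locale covers both \<open>algB\<close> and \<open>algN\<close>.\<close>

locale lie_closed =
  fixes L :: "'g lie_alg"
  assumes add_mem: "x \<in> carrier L \<Longrightarrow> y \<in> carrier L \<Longrightarrow> x \<oplus>\<^bsub>L\<^esub> y \<in> carrier L"
    and smult_mem: "x \<in> carrier L \<Longrightarrow> c \<odot>\<^bsub>L\<^esub> x \<in> carrier L"
    and bracket_mem: "x \<in> carrier L \<Longrightarrow> y \<in> carrier L \<Longrightarrow> bracket L x y \<in> carrier L"
begin

abbreviation "FA \<equiv> free_algebra (carrier L)"

lemma uea_rel_subset: "uea_rel L \<subseteq> carrier FA"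
  by (auto simp: uea_rel_def intro!: free_algebra_closed add_mem smult_mem bracket_mem)

lemma ideal_uea_ideal: "ideal (uea_ideal L) FA"
  unfolding uea_ideal_def using uea_rel_subset by (rule ring.genideal_ideal[OF ring_free_algebra])

lemma uea_ideal_zero: "0 \<in> uea_ideal L"
  using additive_subgroup.zero_closed[OF ideal.axioms(1)[OF ideal_uea_ideal]] by simp

lemma uea_ideal_add: "p \<in> uea_ideal L \<Longrightarrow> q \<in> uea_ideal L \<Longrightarrow> p + q \<in> uea_ideal L"
  using additive_subgroup.a_closed[OF ideal.axioms(1)[OF ideal_uea_ideal]] by simp

lemma uea_ideal_mult_left: "p \<in> uea_ideal L \<Longrightarrow> q \<in> carrier FA \<Longrightarrow> q * p \<in> uea_ideal L"
  using ideal.I_l_closed[OF ideal_uea_ideal] by simp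

lemma uea_ideal_mult_right: "p \<in> uea_ideal L \<Longrightarrow> q \<in> carrier FA \<Longrightarrow> p * q \<in> uea_ideal L"
  using ideal.I_r_closed[OF ideal_uea_ideal] by simp

lemma ring_uea: "ring (uea L)"
  unfolding uea_def by (rule ideal.quotient_is_ring[OF ideal_uea_ideal])

lemma uea_rel_mem: "r \<in> uea_rel L \<Longrightarrow> r \<in> uea_ideal L"
  unfolding uea_ideal_def using ring.genideal_self[OF ring_free_algebra uea_rel_subset] by blast

lemma uea_ideal_minimal: "ideal A FA \<Longrightarrow> uea_rel L \<subseteq> A \<Longrightarrow> uea_ideal L \<subseteq> A"
  unfolding uea_ideal_def by (rule ring.genideal_minimal[OF ring_free_algebra])

lemma carrier_uea: "carrier (uea L) = uea_class L ` carrier FA"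
  by (auto simp: uea_def FactRing_def A_RCOSETS_def' uea_class_def)

lemma uea_class_mem [simp]: "p \<in> carrier FA \<Longrightarrow> uea_class L p \<in> carrier (uea L)"
  by (simp add: carrier_uea)

lemma uea_class_add:
  "p \<in> carrier FA \<Longrightarrow> q \<in> carrier FA \<Longrightarrow> uea_class L p \<oplus>\<^bsub>uea L\<^esub> uea_class L q = uea_class L (p + q)"
  by (simp add: uea_def FactRing_def uea_class_def ideal.a_rcos_sum[OF ideal_uea_ideal])

lemma uea_class_mult:
  "p \<in> carrier FA \<Longrightarrow> q \<in> carrier FA \<Longrightarrow> uea_class L p \<otimes>\<^bsub>uea L\<^esub> uea_class L q = uea_class L (p * q)"
  by (simp add: uea_def FactRing_def uea_class_def ideal.rcoset_mult_add[OF ideal_uea_ideal])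

lemma uea_class_altdef: "uea_class L p = {u + p | u. u \<in> uea_ideal L}"
  by (auto simp: uea_class_def a_r_coset_def')

lemma uea_class_eqI:
  assumes "p \<in> carrier FA" "q \<in> carrier FA" "p - q \<in> uea_ideal L"
  shows "uea_class L p = uea_class L q"
proof -
  have "p \<in> uea_class L q" using assms(3) by (force simp: uea_class_altdef)
  with assms(2) show ?thesis
    using ideal_uea_ideal unfolding uea_class_def
    by (metis abelian_group.a_repr_independence additive_subgroup.a_subgroup ideal.axioms(1,2) ring.is_abelian_group)
qed

text \<open>The kernel of evaluation is an ideal. It contains the linear relations since \<phi> is
  linear, and the bracket relations since \<phi> kills brackets and its values commute.\<close>

lemma free_eval_uea_ideal:
  assumes \<phi>: "\<phi> \<in> lie_hom L abelian_complex" and "p \<in> uea_ideal L"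
  shows "free_eval \<phi> p = 0"
proof -
  let ?A = "{p \<in> carrier FA. free_eval \<phi> p = 0}"
  have "ideal ?A FA"
    by (rule free_algebra_idealI) (auto simp: free_eval_add free_eval_mult carrier_free_algebra[of 0])
  moreover have "free_eval \<phi> r = 0" if "r \<in> uea_rel L" for r
    using \<phi> that
    by (auto simp: uea_rel_def lie_hom_def abelian_complex_def free_eval_diff free_eval_add free_eval_mult)
  then have "uea_rel L \<subseteq> ?A" using uea_rel_subset by blast
  ultimately show ?thesis using uea_ideal_minimal assms(2) by blast
qed

text \<open>The image of the coset under evaluation is a singleton, which gives
  \<open>the_elem\<close> in \<open>uea_char\<close> its meaning.\<close>

lemma uea_char_uea_class:
  assumes "\<phi> \<in> lie_hom L abelian_complex"
  shows "uea_char \<phi> (uea_class L p) = free_eval \<phi> p"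
proof -
  have "free_eval \<phi> ` uea_class L p = {free_eval \<phi> p}"
    using free_eval_uea_ideal[OF assms] additive_subgroup.zero_closed[OF ideal.axioms(1)[OF ideal_uea_ideal]]
    by (auto simp: uea_class_altdef free_eval_add image_iff intro!: exI[of _ p] exI[of _ 0])
  then show ?thesis by (simp add: uea_char_def)
qed

end

section \<open>Left modules, quotients and extension of scalars\<close>

text \<open>Factor groups come as multiplicative groups; this transfers their axioms to the additive
  fields of a module record.\<close>

lemma abelian_group_of_comm_group:
  assumes "comm_group G" "carrier M = carrier G" "add M = monoid.mult G" "\<zero>\<^bsub>M\<^esub> = one G"
  shows "abelian_group M"
proof -
  interpret comm_group G by fact
  show ?thesis
    by (rule abelian_groupI) (auto simp: assms(2-) m_ac intro: l_inv)
qed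

locale left_module = ring R + M?: abelian_group M
  for R :: "('r, 'n) ring_scheme" (structure) and M :: "('r, 'm) module" (structure) +
  assumes smult_closed [simp, intro]:
      "\<lbrakk>a \<in> carrier R; x \<in> carrier M\<rbrakk> \<Longrightarrow> a \<odot>\<^bsub>M\<^esub> x \<in> carrier M"
    and smult_l_distr:
      "\<lbrakk>a \<in> carrier R; b \<in> carrier R; x \<in> carrier M\<rbrakk> \<Longrightarrow> (a \<oplus> b) \<odot>\<^bsub>M\<^esub> x = a \<odot>\<^bsub>M\<^esub> x \<oplus>\<^bsub>M\<^esub> b \<odot>\<^bsub>M\<^esub> x"
    and smult_r_distr:
      "\<lbrakk>a \<in> carrier R; x \<in> carrier M; y \<in> carrier M\<rbrakk> \<Longrightarrow> a \<odot>\<^bsub>M\<^esub> (x \<oplus>\<^bsub>M\<^esub> y) = a \<odot>\<^bsub>M\<^esub> x \<oplus>\<^bsub>M\<^esub> a \<odot>\<^bsub>M\<^esub> y"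
    and smult_assoc:
      "\<lbrakk>a \<in> carrier R; b \<in> carrier R; x \<in> carrier M\<rbrakk> \<Longrightarrow> (a \<otimes> b) \<odot>\<^bsub>M\<^esub> x = a \<odot>\<^bsub>M\<^esub> (b \<odot>\<^bsub>M\<^esub> x)"
    and smult_one [simp]: "x \<in> carrier M \<Longrightarrow> \<one> \<odot>\<^bsub>M\<^esub> x = x"
begin

lemma smult_r_null:
  assumes a: "a \<in> carrier R" shows "a \<odot>\<^bsub>M\<^esub> \<zero>\<^bsub>M\<^esub> = \<zero>\<^bsub>M\<^esub>"
  using smult_r_distr[OF a, of "\<zero>\<^bsub>M\<^esub>" "\<zero>\<^bsub>M\<^esub>"] a
  by (metis M.add.r_cancel_one' M.l_zero M.zero_closed smult_closed)

lemma smult_r_minus: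
  assumes "a \<in> carrier R" "x \<in> carrier M" shows "a \<odot>\<^bsub>M\<^esub> (\<ominus>\<^bsub>M\<^esub> x) = \<ominus>\<^bsub>M\<^esub> (a \<odot>\<^bsub>M\<^esub> x)"
  using smult_r_distr[of a "\<ominus>\<^bsub>M\<^esub> x" x] assms
  by (metis M.a_inv_closed M.l_neg M.minus_equality smult_closed smult_r_null)

context
  fixes J
  assumes J: "additive_subgroup J M"
    and J_smult: "\<And>a x. a \<in> carrier R \<Longrightarrow> x \<in> J \<Longrightarrow> a \<odot>\<^bsub>M\<^esub> x \<in> J"
begin

interpretation J: abelian_subgroup J M
  using J M.abelian_group_axioms by (rule abelian_subgroupI3)

text \<open>The union in \<open>quot_module\<close> ranges over all representatives. Each differs
  from \<open>x\<close> by some \<open>h\<close> in \<open>J\<close>, and \<open>a\<close> maps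
  \<open>h\<close> into \<open>J\<close>, so all cosets in the union agree.\<close>

lemma smult_quot_module:
  assumes a: "a \<in> carrier R" and x: "x \<in> carrier M"
  shows "a \<odot>\<^bsub>quot_module M J\<^esub> (J +>\<^bsub>M\<^esub> x) = J +>\<^bsub>M\<^esub> (a \<odot>\<^bsub>M\<^esub> x)"
proof -
  have "J +>\<^bsub>M\<^esub> (a \<odot>\<^bsub>M\<^esub> y) = J +>\<^bsub>M\<^esub> (a \<odot>\<^bsub>M\<^esub> x)" if "y \<in> J +>\<^bsub>M\<^esub> x" for y
  proof -
    obtain h where h: "h \<in> J" "y = h \<oplus>\<^bsub>M\<^esub> x"
      using \<open>y \<in> J +>\<^bsub>M\<^esub> x\<close> by (auto simp: a_r_coset_def')
    have "a \<odot>\<^bsub>M\<^esub> y = a \<odot>\<^bsub>M\<^esub> h \<oplus>\<^bsub>M\<^esub> a \<odot>\<^bsub>M\<^esub> x"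
      using h a x by (simp add: smult_r_distr)
    then have "a \<odot>\<^bsub>M\<^esub> y \<in> J +>\<^bsub>M\<^esub> (a \<odot>\<^bsub>M\<^esub> x)"
      using J_smult[OF a h(1)] by (auto simp: a_r_coset_def')
    then show ?thesis
      using M.a_repr_independence[OF _ _ J.a_subgroup] a x by (metis smult_closed)
  qed
  moreover have "x \<in> J +>\<^bsub>M\<^esub> x" using x by (rule J.a_rcos_self)
  ultimately have "(\<Union>y\<in>J +>\<^bsub>M\<^esub> x. J +>\<^bsub>M\<^esub> (a \<odot>\<^bsub>M\<^esub> y)) = J +>\<^bsub>M\<^esub> (a \<odot>\<^bsub>M\<^esub> x)"
    by (intro UN_constant_eq) blast+
  then show ?thesis by (simp only: quot_module_def module.simps)
qed

lemma left_module_quot: "left_module R (quot_module M J)"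
proof -
  have grp: "abelian_group (quot_module M J)"
    by (rule abelian_group_of_comm_group[OF J.a_factorgroup_is_comm_group])
      (simp_all add: quot_module_def A_FactGroup_def')
  have elim: "\<exists>x\<in>carrier M. X = J +>\<^bsub>M\<^esub> x" if "X \<in> carrier (quot_module M J)" for X
    using that by (auto simp: quot_module_def A_RCOSETS_def')
  have intro: "J +>\<^bsub>M\<^esub> x \<in> carrier (quot_module M J)" if "x \<in> carrier M" for x
    using that by (auto simp: quot_module_def A_RCOSETS_def')
  have add: "(J +>\<^bsub>M\<^esub> x) \<oplus>\<^bsub>quot_module M J\<^esub> (J +>\<^bsub>M\<^esub> y) = J +>\<^bsub>M\<^esub> (x \<oplus>\<^bsub>M\<^esub> y)"
    if "x \<in> carrier M" "y \<in> carrier M" for x y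
    using that by (simp add: quot_module_def J.a_rcos_sum)
  show ?thesis
    by (intro left_module.intro left_module_axioms.intro ring_axioms grp)
      (auto dest!: elim simp: smult_quot_module add intro smult_l_distr smult_r_distr smult_assoc)
qed

end

end

section \<open>The submodule generated by the products with a set of central elements\<close>

lemma (in left_module) additive_subgroup_ideal_times:
  assumes "I \<subseteq> carrier R" shows "additive_subgroup (ideal_times I M) M"
  unfolding ideal_times_def
  by (intro additive_subgroup.intro group.generate_is_subgroup M.a_group) (use assms in auto)

text \<open>Centrality gives \<open>r (a y) = a (r y)\<close>, so \<open>r\<close> maps generators
  of the subgroup to generators; additivity of the action does the rest.\<close>

lemma (in left_module) smult_ideal_times:
  assumes I: "I \<subseteq> carrier R" and central: "\<And>a r. a \<in> I \<Longrightarrow> r \<in> carrier R \<Longrightarrow> r \<otimes> a = a \<otimes> r"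
    and r: "r \<in> carrier R" and "x \<in> ideal_times I M"
  shows "r \<odot>\<^bsub>M\<^esub> x \<in> ideal_times I M"
  using assms(4) unfolding ideal_times_def
proof (induction rule: generate.induct)
  case one
  then show ?case using generate.one[of "add_monoid M"] r by (simp add: smult_r_null)
next
  case (incl h)
  then obtain a y where h: "h = a \<odot>\<^bsub>M\<^esub> y" "a \<in> I" "y \<in> carrier M" by blast
  then have "r \<odot>\<^bsub>M\<^esub> h = a \<odot>\<^bsub>M\<^esub> (r \<odot>\<^bsub>M\<^esub> y)"
    using I r central[of a r] by (metis smult_assoc subsetD)
  with h r show ?case by (auto intro!: generate.incl)
next
  case (inv h)
  then obtain a y where h: "h = a \<odot>\<^bsub>M\<^esub> y" "a \<in> I" "y \<in> carrier M" by blast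
  then have eq: "r \<odot>\<^bsub>M\<^esub> h = a \<odot>\<^bsub>M\<^esub> (r \<odot>\<^bsub>M\<^esub> y)"
    using I r central[of a r] by (metis smult_assoc subsetD)
  have "h \<in> carrier M" using h I by auto
  then have "r \<odot>\<^bsub>M\<^esub> (inv\<^bsub>add_monoid M\<^esub> h) = inv\<^bsub>add_monoid M\<^esub> (r \<odot>\<^bsub>M\<^esub> h)"
    using r smult_r_minus[of r h] by (simp add: a_inv_def)
  moreover have "r \<odot>\<^bsub>M\<^esub> h \<in> {a \<odot>\<^bsub>M\<^esub> x |a x. a \<in> I \<and> x \<in> carrier M}"
    unfolding eq using h r by auto
  ultimately show ?case by (simp only: generate.inv)
next
  case (eng h1 h2)
  have "generate (add_monoid M) {a \<odot>\<^bsub>M\<^esub> x |a x. a \<in> I \<and> x \<in> carrier M} \<subseteq> carrier M"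
    using group.generate_incl[OF M.a_group, of "{a \<odot>\<^bsub>M\<^esub> x |a x. a \<in> I \<and> x \<in> carrier M}"] I by auto
  then have "h1 \<in> carrier M" "h2 \<in> carrier M" using eng.hyps by blast+
  then show ?case
    using generate.eng[OF eng.IH] r by (simp add: smult_r_distr)
qed

section \<open>Extension of scalars\<close>

locale extension_of_scalars = S: ring S
  for R :: "('r, 'n) ring_scheme" and S :: "('s, 'm) ring_scheme"
    and f :: "'r \<Rightarrow> 's" and Q :: "('r, 'q) module" +
  assumes f_closed: "r \<in> carrier R \<Longrightarrow> f r \<in> carrier S"
    and add_closed: "q \<in> carrier Q \<Longrightarrow> p \<in> carrier Q \<Longrightarrow> q \<oplus>\<^bsub>Q\<^esub> p \<in> carrier Q"
    and smult_closed: "r \<in> carrier R \<Longrightarrow> q \<in> carrier Q \<Longrightarrow> r \<odot>\<^bsub>Q\<^esub> q \<in> carrier Q"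
begin

abbreviation "F \<equiv> tensor_free S Q"
abbreviation "N \<equiv> tensor_null R S f Q"
abbreviation "T \<equiv> induced_module R S f Q"

text \<open>Left multiplication on the first tensor factor, before passing to the quotient by
  \<open>N\<close>.\<close>

definition lmul :: "'s \<Rightarrow> ('s \<times> 'q \<Rightarrow>\<^sub>0 int) \<Rightarrow> ('s \<times> 'q \<Rightarrow>\<^sub>0 int)"
  where "lmul s = frag_extend (\<lambda>(t, q). frag_of (s \<otimes>\<^bsub>S\<^esub> t, q))"

text \<open>The pure tensor of \<open>s\<close> and \<open>q\<close>.\<close>

definition tens :: "'s \<Rightarrow> 'q \<Rightarrow> ('s \<times> 'q \<Rightarrow>\<^sub>0 int) set"
  where "tens s q = N #>\<^bsub>F\<^esub> frag_of (s, q)"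

lemma lmul_frag_of [simp]: "lmul s (frag_of (t, q)) = frag_of (s \<otimes>\<^bsub>S\<^esub> t, q)"
  by (simp add: lmul_def)

lemma lmul_add: "lmul s (c + d) = lmul s c + lmul s d"
  by (simp add: lmul_def frag_extend_add)

lemma lmul_diff: "lmul s (c - d) = lmul s c - lmul s d"
  by (simp add: lmul_def frag_extend_diff)

lemma lmul_uminus: "lmul s (- c) = - lmul s c"
  by (simp add: lmul_def frag_extend_minus)

lemma lmul_0 [simp]: "lmul s 0 = 0"
  by (simp add: lmul_def)

lemma F_comm_group: "comm_group F"
  by (simp add: tensor_free_def abelian_free_Abelian_group)

lemma F_group: "group F"
  using F_comm_group comm_group_def by blast

lemma carrier_F: "c \<in> carrier F \<longleftrightarrow> Poly_Mapping.keys c \<subseteq> carrier S \<times> carrier Q"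
  by (simp add: tensor_free_def)

lemma mult_F [simp]: "c \<otimes>\<^bsub>F\<^esub> d = c + d"
  by (simp add: tensor_free_def)

lemma one_F [simp]: "\<one>\<^bsub>F\<^esub> = 0"
  by (simp add: tensor_free_def)

lemma inv_F [simp]: "c \<in> carrier F \<Longrightarrow> inv\<^bsub>F\<^esub> c = - c"
  by (simp add: tensor_free_def)

lemma frag_of_F [simp]: "frag_of (s, q) \<in> carrier F \<longleftrightarrow> s \<in> carrier S \<and> q \<in> carrier Q"
  by (simp add: tensor_free_def)

lemma add_F [intro, simp]: "c \<in> carrier F \<Longrightarrow> d \<in> carrier F \<Longrightarrow> c + d \<in> carrier F"
  using group.is_monoid[OF F_group] monoid.m_closed[of F c d] by simp

lemma uminus_F [intro, simp]: "c \<in> carrier F \<Longrightarrow> - c \<in> carrier F"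
  by (simp add: carrier_F)

lemma diff_F [intro, simp]: "c \<in> carrier F \<Longrightarrow> d \<in> carrier F \<Longrightarrow> c - d \<in> carrier F"
  using add_F[of c "- d"] by simp

lemma F_induct [consumes 1, case_names zero frag diff]:
  assumes "c \<in> carrier F" and "P 0"
    and "\<And>s q. s \<in> carrier S \<Longrightarrow> q \<in> carrier Q \<Longrightarrow> P (frag_of (s, q))"
    and "\<And>c d. c \<in> carrier F \<Longrightarrow> d \<in> carrier F \<Longrightarrow> P c \<Longrightarrow> P d \<Longrightarrow> P (c - d)"
  shows "P c"
  using assms(1)[unfolded carrier_F]
  by (rule free_Abelian_group_induct) (use assms(2-4) carrier_F in auto)

lemma rel_F: "tensor_rel R S f Q \<subseteq> carrier F"
  by (auto simp: tensor_rel_def f_closed add_closed smult_closed)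

lemma N_subgroup: "subgroup N F"
  unfolding tensor_null_def using rel_F by (rule group.generate_is_subgroup[OF F_group])

lemma N_F: "c \<in> N \<Longrightarrow> c \<in> carrier F"
  using subgroup.subset[OF N_subgroup] by blast

lemma N_normal: "N \<lhd> F"
  using F_comm_group N_subgroup by (rule comm_group.subgroup_imp_normal)

lemma N_rel: "c \<in> tensor_rel R S f Q \<Longrightarrow> c \<in> N"
  unfolding tensor_null_def by (rule generate.incl)

lemma N_add_left: "s \<in> carrier S \<Longrightarrow> t \<in> carrier S \<Longrightarrow> q \<in> carrier Q \<Longrightarrow>
    frag_of (s \<oplus>\<^bsub>S\<^esub> t, q) - (frag_of (s, q) + frag_of (t, q)) \<in> N"
  by (rule N_rel, unfold tensor_rel_def) blast

lemma N_0 [simp]: "0 \<in> N"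
  using subgroup.one_closed[OF N_subgroup] by simp

lemma N_add: "c \<in> N \<Longrightarrow> d \<in> N \<Longrightarrow> c + d \<in> N"
  using subgroup.m_closed[OF N_subgroup] by fastforce

lemma N_uminus: "c \<in> N \<Longrightarrow> - c \<in> N"
  using subgroup.m_inv_closed[OF N_subgroup] N_F by fastforce

lemma N_diff: "c \<in> N \<Longrightarrow> d \<in> N \<Longrightarrow> c - d \<in> N"
  using N_add[of c "- d"] N_uminus by simp

lemma lmul_F:
  assumes "c \<in> carrier F" and s: "s \<in> carrier S" shows "lmul s c \<in> carrier F"
  using assms(1) by (induction rule: F_induct) (auto simp: lmul_diff s carrier_F[of 0])

text \<open>Each of the three families is preserved separately: the first by distributivity in
  \<open>S\<close>, the third by associativity \<open>s (t (f r)) = (s t) (f r)\<close>.\<close>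

lemma lmul_rel:
  assumes "c \<in> tensor_rel R S f Q" and s: "s \<in> carrier S"
  shows "lmul s c \<in> tensor_rel R S f Q"
  using assms(1) unfolding tensor_rel_def
  by (elim UnE) (auto simp: lmul_diff lmul_add s f_closed S.r_distr S.m_assoc[symmetric];
      (metis s S.m_closed))+

lemma lmul_N:
  assumes "c \<in> N" and s: "s \<in> carrier S" shows "lmul s c \<in> N"
  using assms(1)[unfolded tensor_null_def]
proof (induction rule: generate.induct)
  case one
  then show ?case by simp
next
  case (incl h)
  then show ?case using N_rel lmul_rel s by blast
next
  case (inv h)
  then have "h \<in> carrier F" using rel_F by blast
  then show ?case using N_rel lmul_rel[OF inv s] by (simp add: lmul_uminus N_uminus)
next
  case (eng h1 h2)
  then show ?case by (simp add: lmul_add N_add)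
qed

lemma coset_eqI:
  assumes "c \<in> carrier F" "d \<in> carrier F" "c - d \<in> N"
  shows "N #>\<^bsub>F\<^esub> c = N #>\<^bsub>F\<^esub> d"
proof -
  have "c \<in> N #>\<^bsub>F\<^esub> d" using assms(3) by (auto simp: r_coset_def intro!: bexI[of _ "c - d"])
  then show ?thesis using group.repr_independence[OF F_group _ assms(2) N_subgroup] by simp
qed

lemma coset_T [simp]: "c \<in> carrier F \<Longrightarrow> N #>\<^bsub>F\<^esub> c \<in> carrier T"
  by (auto simp: induced_module_def Let_def FactGroup_def RCOSETS_def)

lemma T_cases:
  assumes "X \<in> carrier T" obtains c where "c \<in> carrier F" "X = N #>\<^bsub>F\<^esub> c"
  using assms by (auto simp: induced_module_def Let_def FactGroup_def RCOSETS_def)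

lemma add_T:
  "c \<in> carrier F \<Longrightarrow> d \<in> carrier F \<Longrightarrow>
    (N #>\<^bsub>F\<^esub> c) \<oplus>\<^bsub>T\<^esub> (N #>\<^bsub>F\<^esub> d) = N #>\<^bsub>F\<^esub> (c + d)"
  using normal.rcos_sum[OF N_normal, of c d]
  by (simp add: induced_module_def Let_def FactGroup_def)

lemma T_abelian_group: "abelian_group T"
  by (rule abelian_group_of_comm_group[OF comm_group.abelian_FactGroup[OF F_comm_group N_subgroup]])
    (simp_all add: induced_module_def Let_def)

text \<open>Representatives of a coset differ by an element of \<open>N\<close>, and
  \<open>lmul s\<close> preserves \<open>N\<close>, so the union in \<open>induced_module\<close> is
  a single coset.\<close>

lemma smult_T:
  assumes c: "c \<in> carrier F" and s: "s \<in> carrier S"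
  shows "s \<odot>\<^bsub>T\<^esub> (N #>\<^bsub>F\<^esub> c) = N #>\<^bsub>F\<^esub> lmul s c"
proof -
  have "N #>\<^bsub>F\<^esub> lmul s d = N #>\<^bsub>F\<^esub> lmul s c" if "d \<in> N #>\<^bsub>F\<^esub> c" for d
  proof -
    obtain h where "h \<in> N" "d = h + c" using \<open>d \<in> N #>\<^bsub>F\<^esub> c\<close> by (auto simp: r_coset_def)
    then show ?thesis
      using c s N_F lmul_N by (intro coset_eqI) (auto simp: lmul_add intro!: lmul_F)
  qed
  moreover have "c \<in> N #>\<^bsub>F\<^esub> c" using c by (rule group.rcos_self[OF F_group _ N_subgroup])
  ultimately have "(\<Union>d\<in>N #>\<^bsub>F\<^esub> c. N #>\<^bsub>F\<^esub> lmul s d) = N #>\<^bsub>F\<^esub> lmul s c"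
    by (intro UN_constant_eq) blast+
  then show ?thesis by (simp only: induced_module_def Let_def lmul_def module.simps)
qed

lemma lmul_mult: "c \<in> carrier F \<Longrightarrow> s \<in> carrier S \<Longrightarrow> t \<in> carrier S \<Longrightarrow>
    lmul (s \<otimes>\<^bsub>S\<^esub> t) c = lmul s (lmul t c)"
  by (induction rule: F_induct) (auto simp: lmul_diff S.m_assoc)

lemma lmul_one: "c \<in> carrier F \<Longrightarrow> lmul \<one>\<^bsub>S\<^esub> c = c"
  by (induction rule: F_induct) (auto simp: lmul_diff)

text \<open>In contrast to the other module laws, this one fails in the free group and holds only
  modulo \<open>N\<close>: on a generator the difference is a tensor relation.\<close>

lemma lmul_l_distr:
  assumes "c \<in> carrier F" and s: "s \<in> carrier S" and t: "t \<in> carrier S"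
  shows "lmul (s \<oplus>\<^bsub>S\<^esub> t) c - (lmul s c + lmul t c) \<in> N"
  using assms(1)
proof (induction rule: F_induct)
  case (frag u q)
  then show ?case using s t by (simp add: S.l_distr N_add_left)
next
  case (diff c d)
  from N_diff[OF diff(3,4)] show ?case by (simp add: lmul_diff algebra_simps)
qed simp

lemma left_module_T: "left_module S T"
proof (intro left_module.intro left_module_axioms.intro S.ring_axioms T_abelian_group)
  fix s t X assume s: "s \<in> carrier S" and t: "t \<in> carrier S" and "X \<in> carrier T"
  then show "(s \<oplus>\<^bsub>S\<^esub> t) \<odot>\<^bsub>T\<^esub> X = s \<odot>\<^bsub>T\<^esub> X \<oplus>\<^bsub>T\<^esub> t \<odot>\<^bsub>T\<^esub> X"
    using coset_eqI[OF _ _ lmul_l_distr[OF _ s t]]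
    by (elim T_cases) (simp add: smult_T add_T lmul_F)
qed (auto elim!: T_cases simp: smult_T add_T lmul_F lmul_add lmul_mult lmul_one)

lemma tens_closed [simp]: "s \<in> carrier S \<Longrightarrow> q \<in> carrier Q \<Longrightarrow> tens s q \<in> carrier T"
  by (simp add: tens_def)

lemma tens_add: "s \<in> carrier S \<Longrightarrow> t \<in> carrier S \<Longrightarrow> q \<in> carrier Q \<Longrightarrow>
    tens (s \<oplus>\<^bsub>S\<^esub> t) q = tens s q \<oplus>\<^bsub>T\<^esub> tens t q"
  unfolding tens_def
  by (subst add_T, simp, simp, rule coset_eqI) (simp_all add: N_add_left)

lemma tens_balanced: "s \<in> carrier S \<Longrightarrow> r \<in> carrier R \<Longrightarrow> q \<in> carrier Q \<Longrightarrow>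
    tens (s \<otimes>\<^bsub>S\<^esub> f r) q = tens s (r \<odot>\<^bsub>Q\<^esub> q)"
  unfolding tens_def
  by (rule coset_eqI) (auto simp: tensor_rel_def f_closed smult_closed intro!: N_rel)

lemma smult_tens: "s \<in> carrier S \<Longrightarrow> t \<in> carrier S \<Longrightarrow> q \<in> carrier Q \<Longrightarrow>
    s \<odot>\<^bsub>T\<^esub> tens t q = tens (s \<otimes>\<^bsub>S\<^esub> t) q"
  by (simp add: tens_def smult_T)

text \<open>Pure tensors generate the tensor product as an abelian group.\<close>

lemma T_induct [consumes 1, case_names zero tens add uminus]:
  assumes "X \<in> carrier T" and "P \<zero>\<^bsub>T\<^esub>"
    and tens: "\<And>s q. s \<in> carrier S \<Longrightarrow> q \<in> carrier Q \<Longrightarrow> P (tens s q)"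
    and add: "\<And>X Y. X \<in> carrier T \<Longrightarrow> Y \<in> carrier T \<Longrightarrow> P X \<Longrightarrow> P Y \<Longrightarrow> P (X \<oplus>\<^bsub>T\<^esub> Y)"
    and uminus: "\<And>X. X \<in> carrier T \<Longrightarrow> P X \<Longrightarrow> P (\<ominus>\<^bsub>T\<^esub> X)"
  shows "P X"
proof -
  interpret T: abelian_group T by (rule T_abelian_group)
  \<comment> \<open>The coset of 0 is idempotent under addition, which in a group singles out the
    zero.\<close>
  have zero: "\<zero>\<^bsub>T\<^esub> = N #>\<^bsub>F\<^esub> 0"
  proof -
    have "0 \<in> carrier F" by (simp add: carrier_F)
    then have "(N #>\<^bsub>F\<^esub> 0) \<oplus>\<^bsub>T\<^esub> (N #>\<^bsub>F\<^esub> 0) = N #>\<^bsub>F\<^esub> 0" "N #>\<^bsub>F\<^esub> 0 \<in> carrier T"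
      by (simp_all add: add_T)
    then show ?thesis by (metis T.add.r_cancel_one')
  qed
  have "P (N #>\<^bsub>F\<^esub> c)" if "c \<in> carrier F" for c
    using that
  proof (induction rule: F_induct)
    case zero
    then show ?case using assms(2) \<open>\<zero>\<^bsub>T\<^esub> = _\<close> by simp
  next
    case (frag s q)
    then show ?case using tens by (simp add: tens_def)
  next
    case (diff c d)
    have "(N #>\<^bsub>F\<^esub> (- d)) \<oplus>\<^bsub>T\<^esub> (N #>\<^bsub>F\<^esub> d) = \<zero>\<^bsub>T\<^esub>"
      using diff by (simp add: add_T zero)
    then have "N #>\<^bsub>F\<^esub> (- d) = \<ominus>\<^bsub>T\<^esub> (N #>\<^bsub>F\<^esub> d)"
      using diff by (metis T.minus_equality coset_T uminus_F)
    then have "N #>\<^bsub>F\<^esub> (c - d) = (N #>\<^bsub>F\<^esub> c) \<oplus>\<^bsub>T\<^esub> \<ominus>\<^bsub>T\<^esub> (N #>\<^bsub>F\<^esub> d)"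
      using add_T[of c "- d"] diff by simp
    then show ?case using diff add uminus by simp
  qed
  then show ?thesis using assms(1) T_cases by metis
qed

end

section \<open>The Lie algebras \<open>\<B>\<close> and \<open>\<nn>\<close>\<close>

lemma lookup_bscale [simp]: "Poly_Mapping.lookup (bscale c f) k = c * Poly_Mapping.lookup f k"
  by (simp add: bscale_def Poly_Mapping.map.rep_eq when_def)

interpretation bvec: Modules.module bscale
  by standard (simp_all add: poly_mapping_eq_iff fun_eq_iff lookup_add distrib_left distrib_right mult.assoc)

lemma bscale_single: "bscale c (Poly_Mapping.single k d) = Poly_Mapping.single k (c * d)"
  by (simp add: bscale_def)

lemma bscale_0 [simp]: "bscale 0 f = 0"
  by (simp add: bscale_def map_eq_zero_iff)

lemma bbracket_xB: "bbracket (xB a i) (xB b j) = basis_bracket (a, i) (b, j)"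
  by (simp add: bbracket_def xB_def bscale_def basis_bracket_def)

interpretation B: lie_closed algB
  by standard (auto simp: algB_def)

lemma carrier_algB [simp]: "carrier algB = UNIV"
  by (simp add: algB_def)

lemma algB_simps [simp]: "bracket algB = bbracket" "smult algB = bscale"
  by (simp_all add: algB_def)

text \<open>As a condition on the support, membership can be checked for brackets on pairs of basis
  elements.\<close>

lemma carrier_algN: "carrier algN = {f. \<forall>(a, i)\<in>Poly_Mapping.keys f. a + int i > 1}"
proof
  show "carrier algN \<subseteq> {f. \<forall>(a, i)\<in>Poly_Mapping.keys f. a + int i > 1}"
  proof -
    have "bvec.span {xB a i | a i. a + int i > 1} \<subseteq> {f. \<forall>(a, i)\<in>Poly_Mapping.keys f. a + int i > 1}"
    proof (rule bvec.span_minimal)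
      show "bvec.subspace {f. \<forall>(a, i)\<in>Poly_Mapping.keys f. a + int i > 1}"
        by (rule bvec.subspaceI) (auto dest!: subsetD[OF keys_add] simp: in_keys_iff)
    qed (auto simp: xB_def)
    then show ?thesis by (simp add: algN_def)
  qed
  show "{f. \<forall>(a, i)\<in>Poly_Mapping.keys f. a + int i > 1} \<subseteq> carrier algN"
  proof
    fix f :: bvec assume "f \<in> {f. \<forall>(a, i)\<in>Poly_Mapping.keys f. a + int i > 1}"
    then have "f \<in> bvec.span {xB a i | a i. a + int i > 1}"
    proof (induction f rule: poly_mapping_add_single_induct)
      case zero
      then show ?case by (simp add: bvec.span_zero)
    next
      case (add k c f)
      have "Poly_Mapping.keys (Poly_Mapping.single k c + f) = insert k (Poly_Mapping.keys f)"
        using add.hyps by (auto simp: in_keys_iff lookup_add lookup_single when_def split: if_splits)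
      with add.prems have k: "fst k + int (snd k) > 1"
        and f: "f \<in> bvec.span {xB a i | a i. a + int i > 1}"
        using add.IH by auto
      have "Poly_Mapping.single k c = bscale c (xB (fst k) (snd k))"
        by (simp add: bscale_single xB_def)
      moreover have "xB (fst k) (snd k) \<in> bvec.span {xB a i | a i. a + int i > 1}"
        using k by (intro bvec.span_base) blast
      ultimately show ?case
        using f by (simp only: bvec.span_add bvec.span_scale)
    qed
    then show "f \<in> carrier algN" by (simp add: algN_def)
  qed
qed

lemma keys_bscale: "Poly_Mapping.keys (bscale c f) \<subseteq> Poly_Mapping.keys f"
  by (auto simp: in_keys_iff)

interpretation N: lie_closed algN
proof
  fix x y c assume x: "x \<in> carrier algN"
  show "c \<odot>\<^bsub>algN\<^esub> x \<in> carrier algN"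
    using x keys_bscale[of c x] unfolding carrier_algN by (auto simp: algN_def algB_def)
  assume y: "y \<in> carrier algN"
  show "x \<oplus>\<^bsub>algN\<^esub> y \<in> carrier algN"
    using x y keys_add[of x y] unfolding carrier_algN by (auto simp: algN_def algB_def)
  have sum: "sum g A \<in> carrier algN" if "\<And>k. k \<in> A \<Longrightarrow> g k \<in> carrier algN" for g :: "int \<times> nat \<Rightarrow> bvec" and A
    using that unfolding carrier_algN by (fastforce dest!: subsetD[OF keys_sum])
  have "bscale d (basis_bracket k l) \<in> carrier algN"
    if k: "k \<in> Poly_Mapping.keys x" and l: "l \<in> Poly_Mapping.keys y" for d k l
  proof -
    obtain a i b j where kl: "k = (a, i)" "l = (b, j)" by fastforce
    have "a + int i > 1" "b + int j > 1" using x y k l kl by (auto simp: carrier_algN)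
    \<comment> \<open>Call \<open>a + i\<close> the weight. Two weights of at least 2 give a bracket
      of weight at least 2 + 2 - 1 = 3; the truncated difference at \<open>i = j = 0\<close> can
      only raise it.\<close>
    then show ?thesis
      by (auto simp: kl basis_bracket_def carrier_algN xB_def bscale_single split: if_splits)
  qed
  moreover have "bracket algN x y = bbracket x y" by (simp add: algN_def algB_def)
  ultimately show "bracket algN x y \<in> carrier algN"
    unfolding bbracket_def by (auto intro!: sum)
qed

section \<open>The filtration by word order\<close>

text \<open>A left ideal need not absorb factors on the right. The factor \<open>q\<close> in
  \<open>rel_mem\<close> thus puts the whole two-sided ideal of relations into \<open>K\<close>,
  whereas \<open>character_mem\<close> without such a factor only speaks of the action on the
  generator \<open>w\<close>.\<close>

locale whittaker_left_ideal =
  fixes \<phi> :: "bvec \<Rightarrow> complex" and K :: "(bvec list \<Rightarrow>\<^sub>0 complex) set"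
  assumes zero_mem: "0 \<in> K"
    and add_mem: "p \<in> K \<Longrightarrow> q \<in> K \<Longrightarrow> p + q \<in> K"
    and mult_mem: "q \<in> K \<Longrightarrow> p * q \<in> K"
    and rel_mem: "r \<in> uea_rel algB \<Longrightarrow> r * q \<in> K"
    and character_mem: "a + int i > 1 \<Longrightarrow> gen (xB a i) - const (\<phi> (xB a i)) \<in> K"
begin

lemma gen_add_mem: "(gen (x + y) - (gen x + gen y)) * q \<in> K"
  by (rule rel_mem) (auto simp: uea_rel_def algB_def)

lemma gen_scale_mem: "(gen (bscale c x) - const c * gen x) * q \<in> K"
  by (rule rel_mem) (auto simp: uea_rel_def algB_def)

lemma gen_bracket_mem: "(gen x * gen y - gen y * gen x - gen (bbracket x y)) * q \<in> K"
  by (rule rel_mem) (auto simp: uea_rel_def algB_def)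

lemma gen_0_mem: "gen 0 * q \<in> K"
  using gen_scale_mem[of 0 0 q] by (simp add: const_0)

definition letter :: "int \<times> nat \<Rightarrow> bvec list \<Rightarrow>\<^sub>0 complex"
  where "letter k = gen (xB (fst k) (snd k))"

definition word :: "(int \<times> nat) list \<Rightarrow> bvec list \<Rightarrow>\<^sub>0 complex"
  where "word ks = prod_list (map letter ks)"

text \<open>The truncation by \<open>nat\<close> is harmless: only letters with \<open>a + i \<le> 1\<close> occur in the words of
  the filtration.\<close>

definition wdeg :: "(int \<times> nat) list \<Rightarrow> nat"
  where "wdeg ks = (\<Sum>(a, i)\<leftarrow>ks. nat (1 - (a + int i)))"

definition wzero :: "(int \<times> nat) list \<Rightarrow> nat"
  where "wzero ks = length (filter (\<lambda>(a, i). a + int i = 1) ks)"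

text \<open>The bound \<open>(D, n)\<close> is strict, so that the limit step of the lexicographic order reads:
  \<open>filt (Suc D) 0\<close> is the union of all \<open>filt D n\<close>.\<close>

inductive filt :: "nat \<Rightarrow> nat \<Rightarrow> (bvec list \<Rightarrow>\<^sub>0 complex) \<Rightarrow> bool" for D n
  where
    ideal: "p \<in> K \<Longrightarrow> filt D n p"
  | add: "filt D n p \<Longrightarrow> filt D n q \<Longrightarrow> filt D n (p + q)"
  | scale: "filt D n p \<Longrightarrow> filt D n (const c * p)"
  | word: "\<forall>(a, i)\<in>set ks. a + int i \<le> 1 \<Longrightarrow> wdeg ks < D \<or> wdeg ks = D \<and> wzero ks < n \<Longrightarrow>
      filt D n (word ks)"

lemma filt_mono:
  assumes "filt D n p" and "D < D' \<or> D = D' \<and> n \<le> n'"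
  shows "filt D' n' p"
  using assms by (induction rule: filt.induct) (auto intro: filt.intros)

lemma filt_cong: "filt D n q \<Longrightarrow> p - q \<in> K \<Longrightarrow> filt D n p"
  using filt.add[OF _ filt.ideal, of D n q "p - q"] by simp

lemma filt_letter:
  assumes "filt D n p" and "a + int i \<le> 1"
  shows "filt (D + nat (1 - (a + int i))) (n + (if a + int i = 1 then 1 else 0)) (letter (a, i) * p)"
  using assms(1)
proof (induction rule: filt.induct)
  case (ideal p)
  then show ?case by (intro filt.ideal mult_mem)
next
  case (add p q)
  then show ?case by (simp add: distrib_left filt.add)
next
  case (scale p c)
  have "letter (a, i) * (const c * p) = const c * (letter (a, i) * p)"
    by (rule const_left_commute[symmetric])
  with scale show ?case by (simp add: filt.scale)
next
  case (word ks)
  have "letter (a, i) * word ks = word ((a, i) # ks)"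
    by (simp add: word_def)
  with word assms(2) show ?case
    by (auto intro!: filt.word simp: wdeg_def wzero_def)
qed

text \<open>No word is strictly below \<open>(0, 0)\<close>, so only combinations of elements of
  \<open>K\<close> remain.\<close>

lemma filt_zero_zero: "filt 0 0 p \<Longrightarrow> p \<in> K"
  by (induction rule: filt.induct) (auto intro: add_mem mult_mem)

text \<open>Only finitely many words enter, so their numbers of letters of degree 0 have a common
  bound.\<close>

lemma filt_Suc_zero:
  assumes "filt (Suc D) 0 p" shows "\<exists>n. filt D n p"
  using assms
proof (induction rule: filt.induct)
  case (add p q)
  then obtain m n where "filt D m p" "filt D n q" by blast
  then have "filt D (max m n) p" "filt D (max m n) q"
    by (auto intro: filt_mono)
  then show ?case by (blast intro: filt.add)
next
  case (word ks)
  then have "filt D (Suc (wzero ks)) (word ks)"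
    by (intro filt.word) auto
  then show ?case ..
qed (blast intro: filt.intros)+

lemma letter_commutator_mem:
  "(letter (a, i) * letter (b, j) - letter (b, j) * letter (a, i) -
    const (of_int ((b - 1) * int i - (a - 1) * int j)) * letter (a + b, i + j - 1)) * q \<in> K"
proof -
  let ?c = "of_int ((b - 1) * int i - (a - 1) * int j) :: complex"
  have "(gen (xB a i) * gen (xB b j) - gen (xB b j) * gen (xB a i) - gen (bscale ?c (xB (a + b) (i + j - 1)))) * q \<in> K"
    using gen_bracket_mem[of "xB a i" "xB b j" q] by (simp add: bbracket_xB basis_bracket_def)
  from add_mem[OF this gen_scale_mem[of ?c "xB (a + b) (i + j - 1)" q]]
  show ?thesis by (simp add: letter_def algebra_simps)
qed

text \<open>Write the word as \<open>k u\<close> and the basis element as \<open>x\<close>. Modulo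
  \<open>K\<close>, \<open>(x - \<phi>(x)) k u = k (x - \<phi>(x)) u + [x, k] u\<close>, and the
  induction hypothesis covers the first summand. The indices of \<open>x\<close> stay arbitrary
  because \<open>[x, k]\<close> may involve another element of \<open>algN\<close>. For the empty
  word the claim is \<open>character_mem\<close>.\<close>

lemma filt_shift_word:
  assumes "\<forall>(a, i)\<in>set ks. a + int i \<le> 1" and "a + int i > 1"
  shows "filt (wdeg ks) (wzero ks) ((letter (a, i) - const (\<phi> (xB a i))) * word ks)"
  using assms
proof (induction ks arbitrary: a i)
  case Nil
  then show ?case
    using character_mem[of a i] by (intro filt.ideal) (simp add: word_def letter_def)
next
  case (Cons k ks)
  obtain b j where k: "k = (b, j)" by fastforce
  have b: "b + int j \<le> 1" and ks: "\<forall>(a, i)\<in>set ks. a + int i \<le> 1"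
    using Cons.prems k by auto
  have wd: "wdeg (k # ks) = wdeg ks + nat (1 - (b + int j))"
    and wz: "wzero (k # ks) = wzero ks + (if b + int j = 1 then 1 else 0)"
    by (simp_all add: k wdeg_def wzero_def)
  let ?c = "of_int ((b - 1) * int i - (a - 1) * int j) :: complex"
  let ?y = "(a + b, i + j - 1)"
  have 1: "filt (wdeg (k # ks)) (wzero (k # ks))
      (letter k * ((letter (a, i) - const (\<phi> (xB a i))) * word ks))"
    unfolding k using filt_letter[OF Cons.IH[OF ks Cons.prems(2)] b] wd[unfolded k] wz[unfolded k] by simp
  \<comment> \<open>The commutator is \<open>?c\<close> times the basis element with index
    \<open>?y\<close>. If \<open>i + j = 0\<close> then \<open>?c = 0\<close>; otherwise the degree
    of \<open>?y\<close> is the sum of those of \<open>x\<close> and \<open>k\<close>, hence less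
    than that of \<open>k\<close>. So if \<open>?y\<close> may occur in a word, putting it in place
    of \<open>k\<close> lowers the total degree.\<close>
  have 2: "filt (wdeg (k # ks)) (wzero (k # ks)) (const ?c * (letter ?y * word ks))"
  proof (cases "i + j = 0")
    case True
    then show ?thesis by (simp add: const_0 zero_mem filt.ideal)
  next
    case False
    then have ij: "int (i + j - 1) = int i + int j - 1" by linarith
    show ?thesis
    proof (cases "a + b + int (i + j - 1) \<le> 1")
      case True
      have "wdeg (?y # ks) < wdeg (k # ks)"
        using True Cons.prems(2) b ij by (simp add: k wdeg_def)
      then have "filt (wdeg (k # ks)) (wzero (k # ks)) (word (?y # ks))"
        using ks True by (intro filt.word) auto
      then show ?thesis by (intro filt.scale) (simp add: word_def)
    next
      case False
      \<comment> \<open>Now \<open>y\<close> lies in \<open>algN\<close>, and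
        \<open>y u = (y - \<phi>(y)) u + \<phi>(y) u\<close>; the induction hypothesis for
        \<open>y\<close> covers the first summand.\<close>
      have "filt (wdeg ks) (Suc (wzero ks)) (word ks)"
        using ks by (intro filt.word) auto
      note 3 = filt.scale[OF this, of "\<phi> (xB (a + b) (i + j - 1))"]
      have "filt (wdeg ks) (Suc (wzero ks))
          ((letter ?y - const (\<phi> (xB (a + b) (i + j - 1)))) * word ks)"
        using Cons.IH[OF ks, of "a + b" "i + j - 1"] False by (auto intro: filt_mono)
      from filt.add[OF this 3] have "filt (wdeg ks) (Suc (wzero ks)) (letter ?y * word ks)"
        by (simp only: left_diff_distrib diff_add_cancel)
      \<comment> \<open>Losing \<open>k\<close> makes exactly enough room: it lowers the number of
        letters of degree 0 by one if \<open>k\<close> has degree 0, and the total degree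
        otherwise.\<close>
      then have "filt (wdeg (k # ks)) (wzero (k # ks)) (letter ?y * word ks)"
        by (rule filt_mono) (use b in \<open>auto simp: wd wz\<close>)
      then show ?thesis by (rule filt.scale)
    qed
  qed
  from filt.add[OF 1 2] show ?case
    by (rule filt_cong)
       (use letter_commutator_mem[of a i b j "word ks"] const_left_commute[of "\<phi> (xB a i)" "letter k" "word ks"]
         in \<open>simp add: word_def k algebra_simps\<close>)
qed

text \<open>A word strictly below \<open>(D, Suc n)\<close> is at most \<open>(D, n)\<close>, and
  its image is strictly below the word itself.\<close>

lemma filt_shift:
  assumes "filt D (Suc n) p" and "a + int i > 1"
  shows "filt D n ((letter (a, i) - const (\<phi> (xB a i))) * p)"
  using assms(1)
proof (induction rule: filt.induct)
  case (ideal p)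
  then show ?case by (intro filt.ideal mult_mem)
next
  case (add p q)
  then show ?case by (simp add: distrib_left filt.add)
next
  case (scale p c)
  have "(letter (a, i) - const (\<phi> (xB a i))) * (const c * p) =
      const c * ((letter (a, i) - const (\<phi> (xB a i))) * p)"
    by (rule const_left_commute[symmetric])
  with scale show ?case by (simp add: filt.scale)
next
  case (word ks)
  from filt_shift_word[OF word(1) assms(2)] show ?case
    by (rule filt_mono) (use word(2) in auto)
qed

section \<open>Exhaustion of the free algebra by the filtration\<close>

lemma exhaust_letter:
  assumes "filt D n p" shows "\<exists>D' n'. filt D' n' (letter k * p)"
proof (cases k)
  case (Pair a i)
  show ?thesis
  proof (cases "a + int i \<le> 1")
    case True
    then show ?thesis using filt_letter[OF assms True] Pair by blast
  next
    case False
    \<comment> \<open>A letter \<open>x\<close> of \<open>algN\<close> is split as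
      \<open>(x - \<phi>(x)) + \<phi>(x)\<close>. The larger bound leaves room for
      \<open>filt_shift\<close>.\<close>
    have s: "filt D (Suc n) p" using assms by (rule filt_mono) simp
    have "filt D (Suc n) ((letter k - const (\<phi> (xB a i))) * p)"
      using filt_shift[OF s, of a i] False Pair by (auto intro: filt_mono)
    from filt.add[OF this filt.scale[OF s, of "\<phi> (xB a i)"]]
    show ?thesis by (auto simp: algebra_simps)
  qed
qed

lemma exhaust_add:
  assumes "\<exists>D n. filt D n p" "\<exists>D n. filt D n q" shows "\<exists>D n. filt D n (p + q)"
proof -
  obtain D n E m where "filt D n p" "filt E m q" using assms by blast
  \<comment> \<open>This limit bound lies above \<open>(D, n)\<close> and \<open>(E, m)\<close>
    whatever \<open>n\<close> and \<open>m\<close> are.\<close>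
  then have "filt (Suc (max D E)) 0 p" "filt (Suc (max D E)) 0 q"
    by (auto elim: filt_mono)
  then show ?thesis by (blast intro: filt.add)
qed

lemma exhaust_gen:
  assumes p: "\<exists>D n. filt D n p" shows "\<exists>D n. filt D n (gen x * p)"
proof (induction x rule: poly_mapping_add_single_induct)
  case zero
  show ?case using gen_0_mem[of p] by (blast intro: filt.ideal)
next
  case (add k c x)
  have "Poly_Mapping.single k c = bscale c (xB (fst k) (snd k))"
    by (simp add: bscale_single xB_def)
  then have m: "(gen (Poly_Mapping.single k c + x) * p - (const c * (letter k * p) + gen x * p)) \<in> K"
    using add_mem[OF gen_add_mem[of "Poly_Mapping.single k c" x p] gen_scale_mem[of c "xB (fst k) (snd k)" p]]
    by (simp add: letter_def algebra_simps)
  have "\<exists>D n. filt D n (const c * (letter k * p))"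
    using p exhaust_letter by (meson filt.scale)
  from exhaust_add[OF this add.IH] show ?case using m by (meson filt_cong)
qed

text \<open>This is the spanning statement: modulo \<open>K\<close>, words in letters of degree at
  least 0 span everything. Arbitrary words are built up by left multiplication with one generator at
  a time.\<close>

lemma filt_exhaustive: "\<exists>D n. filt D n p"
proof (induction p rule: poly_mapping_add_single_induct)
  case zero
  show ?case using zero_mem by (blast intro: filt.ideal)
next
  case (add w c p)
  have "\<exists>D n. filt D n (Poly_Mapping.single w 1)" for w
  proof (induction w)
    case Nil
    have "filt 1 0 (word [])" by (rule filt.word) (auto simp: wdeg_def)
    then show ?case by (auto simp: word_def one_eq_single_Nil)
  next
    case (Cons x w)
    show ?case using exhaust_gen[OF Cons.IH, of x] by (simp add: gen_mult_single)
  qed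
  then have "\<exists>D n. filt D n (Poly_Mapping.single w c)"
    using const_mult_single[of c w 1] by (metis filt.scale mult_1_right)
  from exhaust_add[OF this add.IH] show ?case .
qed

text \<open>\<open>P\<close> stands for the preimage of a submodule. The descent in the
  lexicographic order is an induction on \<open>D\<close> with an inner induction on
  \<open>n\<close>.\<close>

lemma exists_whittaker:
  assumes P: "\<And>p q. p \<in> P \<Longrightarrow> q \<in> P \<Longrightarrow> p + q \<in> P" "\<And>x p. p \<in> P \<Longrightarrow> gen x * p \<in> P"
      "\<And>c p. p \<in> P \<Longrightarrow> const c * p \<in> P"
    and "p \<in> P" "p \<notin> K"
  shows "\<exists>v\<in>P. v \<notin> K \<and> (\<forall>a i. a + int i > 1 \<longrightarrow> (gen (xB a i) - const (\<phi> (xB a i))) * v \<in> K)"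
proof -
  have shift: "(letter (a, i) - const c) * v \<in> P" if "v \<in> P" for a i c v
    using P(1)[OF P(2)[OF that, of "xB a i"] P(3)[OF that, of "- c"]]
    by (simp add: letter_def const_uminus algebra_simps)
  have main: "?thesis" if "filt D n v" "v \<in> P" "v \<notin> K" for D n v
    using that
  proof (induction D arbitrary: n v)
    case 0
    then show ?case
    proof (induction n arbitrary: v)
      case (Suc n)
      \<comment> \<open>Either \<open>v\<close> already is as desired, or some
        \<open>(x - \<phi>(x)) v\<close> lies outside \<open>K\<close>; it stays in \<open>P\<close>
        and has the smaller bound \<open>(0, n)\<close>.\<close>
      then show ?case using filt_shift shift by (metis letter_def fst_conv snd_conv)
    qed (use filt_zero_zero in blast)
  next
    case (Suc D)
    show ?case using Suc.prems
    proof (induction n arbitrary: v)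
      case 0
      \<comment> \<open>The limit step gives no control over the new \<open>n\<close>, which is why
        \<open>n\<close> is arbitrary in the outer induction.\<close>
      then show ?case using filt_Suc_zero Suc.IH by blast
    next
      case (Suc n)
      then show ?case using filt_shift shift by (metis letter_def fst_conv snd_conv)
    qed
  qed
  show ?thesis using main assms filt_exhaustive by blast
qed

end

section \<open>Whittaker vectors in \<open>M\<^sub>\<phi> / I M\<^sub>\<phi>\<close>\<close>

text \<open>With \<open>a = 1\<close> and \<open>i = 0\<close> both terms of the bracket coefficient
  vanish, so \<open>z\<close> commutes with generators. Products follow from
  \<open>z p q - p q z = (z p - p z) q + p (z q - q z)\<close>.\<close>

lemma uea_xB_1_0_central:
  "uea_of algB (xB 1 0) \<otimes>\<^bsub>uea algB\<^esub> uea_class algB p = uea_class algB p \<otimes>\<^bsub>uea algB\<^esub> uea_of algB (xB 1 0)"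
proof -
  define z where "z = gen (xB 1 0)"
  have "p \<in> carrier (free_algebra UNIV)" by simp
  then have "z * p - p * z \<in> uea_ideal algB"
  proof (induction p rule: free_algebra_induct)
    case (const c)
    then show ?case using B.uea_ideal_zero by (simp add: const_commute)
  next
    case (gen x)
    have "bbracket (xB 1 0) x = 0"
      by (auto simp: bbracket_def xB_def basis_bracket_def bvec.scale_zero_right intro!: sum.neutral)
    then have "z * gen x - gen x * z - gen 0 \<in> uea_rel algB"
      using uea_rel_bracketI[of "xB 1 0" algB x] by (simp add: z_def)
    \<comment> \<open>The generator \<open>gen 0\<close> is not zero in the free algebra; the
      scaling relation with \<open>c = 0\<close> puts it into the ideal.\<close>
    moreover have "gen 0 - const 0 * gen 0 \<in> uea_rel algB"
      using uea_rel_smultI[of 0 algB 0] by simp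
    ultimately show ?case
      using B.uea_ideal_add[of "z * gen x - gen x * z - gen 0" "gen 0"] B.uea_rel_mem
      by (simp add: const_0)
  next
    case (add p q)
    from B.uea_ideal_add[OF this] show ?case by (simp add: algebra_simps)
  next
    case (mult p q)
    have "(z * p - p * z) * q + p * (z * q - q * z) \<in> uea_ideal algB"
      using mult by (simp add: B.uea_ideal_add B.uea_ideal_mult_left B.uea_ideal_mult_right)
    then show ?case by (simp add: algebra_simps)
  qed
  then show ?thesis
    unfolding uea_of_def z_def[symmetric] by (simp add: B.uea_class_mult B.uea_class_eqI)
qed

lemma carrier_ringA: "carrier ringA \<subseteq> carrier (uea algB)"
proof -
  have "range (uea_const algB) \<union> {uea_of algB (xB 1 0)} \<subseteq> carrier (uea algB)"
    by (auto simp: uea_const_def uea_of_def)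
  then show ?thesis
    using ring.generate_ring_incl[OF B.ring_uea] by (simp add: ringA_def)
qed

text \<open>Elements commuting with \<open>u\<close> form a subring, and it contains the scalars and
  \<open>xB 1 0\<close>. This makes \<open>I M\<close> a submodule.\<close>

lemma ringA_central:
  assumes "a \<in> carrier ringA" and u: "u \<in> carrier (uea algB)"
  shows "u \<otimes>\<^bsub>uea algB\<^esub> a = a \<otimes>\<^bsub>uea algB\<^esub> u"
proof -
  interpret U: ring "uea algB" by (rule B.ring_uea)
  have "a \<in> generate_ring (uea algB) (range (uea_const algB) \<union> {uea_of algB (xB 1 0)})"
    using assms(1) by (simp add: ringA_def)
  then have "a \<in> carrier (uea algB) \<and> u \<otimes>\<^bsub>uea algB\<^esub> a = a \<otimes>\<^bsub>uea algB\<^esub> u"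
  proof (induction rule: generate_ring.induct)
    case one
    then show ?case using u by simp
  next
    case (incl h)
    obtain p where "u = uea_class algB p" using u by (auto simp: B.carrier_uea)
    then show ?case
      using incl uea_xB_1_0_central[of p]
      by (auto simp: uea_const_def uea_of_def B.uea_class_mult const_commute)
  next
    case (a_inv h)
    then show ?case using u by (simp add: U.l_minus U.r_minus)
  next
    case (eng_add h1 h2)
    then show ?case using u by (simp add: U.l_distr U.r_distr)
  next
    case (eng_mult h1 h2)
    then show ?case using u by (metis U.m_assoc U.m_closed)
  qed
  then show ?thesis by blast
qed

section \<open>Comparison of the two enveloping algebras and the induced module\<close>

lemma uea_rel_algN_subset: "uea_rel algN \<subseteq> uea_rel algB"
  unfolding uea_rel_def algN_def algB_def by auto

text \<open>The larger ideal, cut down to the free algebra on \<open>algN\<close>, is an ideal there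
  and contains the relations of \<open>algN\<close>.\<close>

lemma uea_ideal_algN_subset: "uea_ideal algN \<subseteq> uea_ideal algB"
proof -
  have "ideal (uea_ideal algB \<inter> carrier N.FA) N.FA"
    using B.uea_ideal_zero B.uea_ideal_add B.uea_ideal_mult_left B.uea_ideal_mult_right
    by (intro free_algebra_idealI) (auto simp: carrier_free_algebra[of 0])
  moreover have "uea_rel algN \<subseteq> uea_ideal algB \<inter> carrier N.FA"
    using uea_rel_algN_subset B.uea_rel_mem N.uea_rel_subset by blast
  ultimately show ?thesis using N.uea_ideal_minimal by blast
qed

text \<open>The ideal of \<open>algB\<close> absorbs that of \<open>algN\<close> when the cosets are
  added.\<close>

lemma uea_incl_uea_class: "uea_incl algB (uea_class algN p) = uea_class algB p"
proof -
  have "0 \<in> uea_ideal algN"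
    by (rule N.uea_ideal_zero)
  moreover have "u + v \<in> uea_ideal algB" if "u \<in> uea_ideal algB" "v \<in> uea_ideal algN" for u v
    using that uea_ideal_algN_subset by (auto intro: B.uea_ideal_add)
  ultimately show ?thesis
    unfolding uea_incl_def B.uea_class_altdef N.uea_class_altdef set_add_def'
    by (auto simp: add.assoc[symmetric])
qed

interpretation ind: extension_of_scalars "uea algN" "uea algB" "uea_incl algB" "char_module \<phi>" for \<phi>
proof (rule extension_of_scalars.intro[OF B.ring_uea], unfold_locales)
  show "uea_incl algB r \<in> carrier (uea algB)" if "r \<in> carrier (uea algN)" for r
    using that by (auto simp: N.carrier_uea uea_incl_uea_class)
qed (auto simp: char_module_def)

lemma left_module_modM: "left_module (uea algB) (modM \<phi>)"
  unfolding modM_def by (rule ind.left_module_T)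

text \<open>The vector \<open>p w\<close>, where the generator \<open>w\<close> is the tensor of 1
  and 1.\<close>

definition tensM :: "(bvec \<Rightarrow> complex) \<Rightarrow> (bvec list \<Rightarrow>\<^sub>0 complex) \<Rightarrow> (uB \<times> complex \<Rightarrow>\<^sub>0 int) set"
  where "tensM \<phi> p = ind.tens \<phi> (uea_class algB p) 1"

lemma carrier_char_module [simp]: "z \<in> carrier (char_module \<phi>)"
  by (simp add: char_module_def)

lemma tensM_closed [simp]: "tensM \<phi> p \<in> carrier (modM \<phi>)"
  unfolding tensM_def modM_def by simp

lemma tensM_add: "tensM \<phi> (p + q) = tensM \<phi> p \<oplus>\<^bsub>modM \<phi>\<^esub> tensM \<phi> q"
  unfolding tensM_def modM_def by (simp add: B.uea_class_add[symmetric] ind.tens_add)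

lemma smult_tensM: "uea_class algB p \<odot>\<^bsub>modM \<phi>\<^esub> tensM \<phi> q = tensM \<phi> (p * q)"
  unfolding tensM_def modM_def by (simp add: B.uea_class_mult[symmetric] ind.smult_tens)

context
  fixes \<phi> assumes \<phi>: "\<phi> \<in> lie_hom algN abelian_complex"
begin

lemma tens_mult:
  assumes "n \<in> carrier N.FA"
  shows "ind.tens \<phi> (uea_class algB (p * n)) z = ind.tens \<phi> (uea_class algB p) (free_eval \<phi> n * z)"
proof -
  have "uea_class algB (p * n) = uea_class algB p \<otimes>\<^bsub>uea algB\<^esub> uea_incl algB (uea_class algN n)"
    by (simp add: uea_incl_uea_class B.uea_class_mult)
  moreover have "uea_class algN n \<odot>\<^bsub>char_module \<phi>\<^esub> z = free_eval \<phi> n * z"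
    by (simp add: char_module_def N.uea_char_uea_class[OF \<phi>])
  ultimately show ?thesis
    using ind.tens_balanced[of "uea_class algB p" "uea_class algN n" z \<phi>] assms by simp
qed

text \<open>Moved across the tensor sign, \<open>gen x\<close> and \<open>const (\<phi> x)\<close>
  both become the scalar \<open>\<phi> x\<close>: the generator \<open>w\<close> is a Whittaker
  vector.\<close>

lemma tensM_gen: "x \<in> carrier algN \<Longrightarrow> tensM \<phi> (gen x) = tensM \<phi> (const (\<phi> x))"
  unfolding tensM_def using tens_mult[of "gen x" 1 1] tens_mult[of "const (\<phi> x)" 1 1] by simp

lemma tens_eq_tensM: "ind.tens \<phi> (uea_class algB p) z = tensM \<phi> (p * const z)"
  unfolding tensM_def by (simp add: tens_mult)

end

lemma tensM_0: "tensM \<phi> 0 = \<zero>\<^bsub>modM \<phi>\<^esub>"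
proof -
  interpret M: left_module "uea algB" "modM \<phi>" by (rule left_module_modM)
  have "tensM \<phi> 0 = tensM \<phi> 0 \<oplus>\<^bsub>modM \<phi>\<^esub> tensM \<phi> 0"
    using tensM_add[of \<phi> 0 0] by simp
  then show ?thesis using tensM_closed by (metis M.M.add.r_cancel_one')
qed

lemma tensM_uminus: "tensM \<phi> (- p) = \<ominus>\<^bsub>modM \<phi>\<^esub> tensM \<phi> p"
proof -
  interpret M: left_module "uea algB" "modM \<phi>" by (rule left_module_modM)
  have "tensM \<phi> (- p) \<oplus>\<^bsub>modM \<phi>\<^esub> tensM \<phi> p = \<zero>\<^bsub>modM \<phi>\<^esub>"
    by (simp add: tensM_add[symmetric] tensM_0)
  then show ?thesis by (intro M.M.minus_equality[symmetric]) simp_all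
qed

text \<open>The module is cyclic on \<open>w\<close>: the scalar in the second factor of a pure
  tensor moves into the first, and sums and negatives of vectors \<open>p w\<close> are again of
  this form.\<close>

lemma tensM_surj:
  assumes \<phi>: "\<phi> \<in> lie_hom algN abelian_complex" and "X \<in> carrier (modM \<phi>)"
  shows "\<exists>p. X = tensM \<phi> p"
  using assms(2) unfolding modM_def
proof (induction rule: ind.T_induct)
  case zero
  show ?case using tensM_0 unfolding modM_def by metis
next
  case (tens s q)
  then show ?case using tens_eq_tensM[OF \<phi>] by (auto simp: B.carrier_uea)
next
  case (add X Y)
  then show ?case using tensM_add unfolding modM_def by metis
next
  case (uminus X)
  then show ?case using tensM_uminus unfolding modM_def by metis
qed

theorem lemma3p2:
  fixes \<phi> :: "bvec \<Rightarrow> complex"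
    and I :: "uB set"
    and W :: "(uB \<times> complex \<Rightarrow>\<^sub>0 int) set set set"
  assumes "\<phi> \<in> lie_hom algN abelian_complex"
    and "nonsingular \<phi>"
    and "ideal I ringA"
    and "lie_submodule algB W (modV \<phi> I)"
    and "W \<noteq> {\<zero>\<^bsub>modV \<phi> I\<^esub>}"
  shows "\<exists>v\<in>W. v \<noteq> \<zero>\<^bsub>modV \<phi> I\<^esub> \<and> whittaker_vector algN \<phi> (modV \<phi> I) v"
proof -
  note \<phi> = assms(1)
  interpret M: left_module "uea algB" "modM \<phi>" by (rule left_module_modM)
  define J where "J = ideal_times I (modM \<phi>)"
  define V where "V = quot_module (modM \<phi>) J"
  have "I \<subseteq> carrier ringA"
    using assms(3) by (rule additive_subgroup.a_subset[OF ideal.axioms(1)])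
  then have I: "I \<subseteq> carrier (uea algB)" and
    central: "\<And>a r. a \<in> I \<Longrightarrow> r \<in> carrier (uea algB) \<Longrightarrow> r \<otimes>\<^bsub>uea algB\<^esub> a = a \<otimes>\<^bsub>uea algB\<^esub> r"
    using carrier_ringA ringA_central by blast+
  have J: "additive_subgroup J (modM \<phi>)"
    unfolding J_def using I by (rule M.additive_subgroup_ideal_times)
  have J_smult: "r \<odot>\<^bsub>modM \<phi>\<^esub> x \<in> J" if "r \<in> carrier (uea algB)" "x \<in> J" for r x
    using M.smult_ideal_times[OF I central that(1)] that(2) unfolding J_def by simp
  interpret J: abelian_subgroup J "modM \<phi>"
    using J M.M.abelian_group_axioms by (rule abelian_subgroupI3)
  interpret V: left_module "uea algB" V
    unfolding V_def using J J_smult by (rule M.left_module_quot)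

  \<comment> \<open>The map \<open>\<pi>\<close> sends \<open>p\<close> to the image of
    \<open>p w\<close>. It maps the free algebra onto \<open>V\<close>, and left multiplication by
    \<open>gen x\<close> becomes the action of \<open>x\<close>.\<close>
  define \<pi> where "\<pi> p = J +>\<^bsub>modM \<phi>\<^esub> tensM \<phi> p" for p
  have closed: "\<pi> p \<in> carrier V" for p
    by (auto simp: \<pi>_def V_def quot_module_def A_RCOSETS_def')
  have surj: "\<exists>p. v = \<pi> p" if "v \<in> carrier V" for v
    using that tensM_surj[OF \<phi>] by (force simp: \<pi>_def V_def quot_module_def A_RCOSETS_def')
  have add: "\<pi> (p + q) = \<pi> p \<oplus>\<^bsub>V\<^esub> \<pi> q" for p q
    by (simp add: \<pi>_def V_def quot_module_def J.a_rcos_sum tensM_add)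
  have smult: "uea_class algB p \<odot>\<^bsub>V\<^esub> \<pi> q = \<pi> (p * q)" for p q
    by (simp add: \<pi>_def V_def M.smult_quot_module[OF J J_smult] smult_tensM)
  have zero: "\<pi> 0 = \<zero>\<^bsub>V\<^esub>"
    using add[of 0 0] closed by (metis V.M.add.r_cancel_one' add_0)
  have eq_iff: "\<pi> p = \<pi> q \<longleftrightarrow> \<pi> (p - q) = \<zero>\<^bsub>V\<^esub>" for p q
    using add[of "p - q" q] closed[of "p - q"] closed[of q]
    by (metis V.M.add.r_cancel_one' V.M.l_zero diff_add_cancel)

  \<comment> \<open>The annihilator of the image of \<open>w\<close>, taken in the free
    algebra.\<close>
  define K where "K = {p. \<pi> p = \<zero>\<^bsub>V\<^esub>}"
  have K_ideal: "p \<in> K" if "p \<in> uea_ideal algB" for p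
  proof -
    have "uea_class algB p = uea_class algB 0"
      using that by (intro B.uea_class_eqI) simp_all
    then have "\<pi> p = \<pi> 0" by (simp add: \<pi>_def tensM_def)
    then show ?thesis by (simp add: K_def zero)
  qed
  interpret K: whittaker_left_ideal \<phi> K
  proof
    show "0 \<in> K" by (simp add: K_def zero)
    show "p + q \<in> K" if "p \<in> K" "q \<in> K" for p q using that by (simp add: K_def add)
    show "p * q \<in> K" if "q \<in> K" for p q
      using that by (simp add: K_def smult[symmetric] V.smult_r_null)
    show "r * q \<in> K" if "r \<in> uea_rel algB" for r q
      using K_ideal B.uea_ideal_mult_right[OF B.uea_rel_mem[OF that], of q] by simp
    show "gen (xB a i) - const (\<phi> (xB a i)) \<in> K" if "a + int i > 1" for a i
    proof -
      have "xB a i \<in> carrier algN" using that by (simp add: carrier_algN xB_def)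
      then have "\<pi> (gen (xB a i)) = \<pi> (const (\<phi> (xB a i)))" by (simp add: \<pi>_def tensM_gen[OF \<phi>])
      then show ?thesis by (simp add: eq_iff K_def)
    qed
  qed

  have modV: "modV \<phi> I = lie_mod_of_uea algB V" by (simp add: modV_def V_def J_def)
  have zeroV: "\<zero>\<^bsub>modV \<phi> I\<^esub> = \<zero>\<^bsub>V\<^esub>" by (simp add: modV lie_mod_of_uea_def)
  have act: "act (modV \<phi> I) x (\<pi> p) = \<pi> (gen x * p)" for x p
    by (simp add: modV lie_mod_of_uea_def uea_of_def smult)
  have scale: "c \<odot>\<^bsub>modV \<phi> I\<^esub> \<pi> p = \<pi> (const c * p)" for c p
    by (simp add: modV lie_mod_of_uea_def uea_const_def smult)
  have W_act: "act (modV \<phi> I) x w \<in> W" if "w \<in> W" for x w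
    using assms(4) that by (auto simp: lie_submodule_def)
  have W': "submodule W complex_field (modV \<phi> I)"
    using assms(4) by (auto simp: lie_submodule_def)
  have sub: "subgroup W (add_monoid (modV \<phi> I))"
    using W' by (rule submodule.axioms(1))
  have W_carrier: "W \<subseteq> carrier V"
    using subgroup.subset[OF sub] by (simp add: modV lie_mod_of_uea_def)
  have W_add: "v \<oplus>\<^bsub>V\<^esub> w \<in> W" if "v \<in> W" "w \<in> W" for v w
    using subgroup.m_closed[OF sub that] by (simp add: modV lie_mod_of_uea_def)
  have W_scale: "c \<odot>\<^bsub>modV \<phi> I\<^esub> w \<in> W" if "w \<in> W" for c w
    using submodule.smult_closed[OF W', of c w] that by (simp add: complex_field_def)
  have "\<zero>\<^bsub>V\<^esub> \<in> W" using subgroup.one_closed[OF sub] by (simp add: zeroV)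
  then obtain w where "w \<in> W" "w \<noteq> \<zero>\<^bsub>V\<^esub>" using assms(5) zeroV by auto
  moreover obtain p where "w = \<pi> p" using W_carrier \<open>w \<in> W\<close> surj by blast
  ultimately have "p \<in> {p. \<pi> p \<in> W}" "p \<notin> K" by (auto simp: K_def)
  \<comment> \<open>The descent runs in the preimage of \<open>W\<close> under
    \<open>\<pi>\<close>.\<close>
  then obtain v where v: "\<pi> v \<in> W" "v \<notin> K"
    and *: "\<And>a i. a + int i > 1 \<Longrightarrow> (gen (xB a i) - const (\<phi> (xB a i))) * v \<in> K"
    using K.exists_whittaker[of "{p. \<pi> p \<in> W}" p] W_add W_act W_scale
    by (auto simp: add act[symmetric] scale[symmetric])

  have \<phi>_add: "\<phi> (x + y) = \<phi> x + \<phi> y" if "x \<in> carrier algN" "y \<in> carrier algN" for x y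
  proof -
    have "\<phi> (x \<oplus>\<^bsub>algN\<^esub> y) = \<phi> x + \<phi> y"
      using \<phi> that by (simp add: lie_hom_def abelian_complex_def)
    then show ?thesis by (simp add: algN_def algB_def)
  qed
  have \<phi>_scale: "\<phi> (bscale c x) = c * \<phi> x" if "x \<in> carrier algN" for c x
  proof -
    have "\<phi> (c \<odot>\<^bsub>algN\<^esub> x) = c * \<phi> x"
      using \<phi> that by (simp add: lie_hom_def abelian_complex_def)
    then show ?thesis by (simp add: algN_def algB_def)
  qed
  \<comment> \<open>The condition, obtained for basis elements of \<open>algN\<close>, extends to
    their span by linearity.\<close>
  have "(gen x - const (\<phi> x)) * v \<in> K" if "x \<in> carrier algN" for x
  proof -
    have "x \<in> bvec.span {xB a i | a i. a + int i > 1}" using that by (simp add: algN_def)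
    \<comment> \<open>Membership is carried along because \<phi> is known to be linear only on
      \<open>algN\<close>.\<close>
    then have "x \<in> carrier algN \<and> (gen x - const (\<phi> x)) * v \<in> K"
    proof (induction rule: bvec.span_induct_alt)
      case base
      have "\<phi> 0 = 0" using \<phi>_scale[of 0 0] by (simp add: carrier_algN)
      then show ?case
        using K.gen_0_mem[of v] by (simp add: carrier_algN const_0)
    next
      case (step c y x)
      then obtain a i where y: "y = xB a i" "a + int i > 1" by blast
      have yN: "y \<in> carrier algN" using y by (simp add: carrier_algN xB_def)
      have cyN: "bscale c y \<in> carrier algN" using N.smult_mem[OF yN, of c] by (simp add: algN_def algB_def)
      have sN: "bscale c y + x \<in> carrier algN"
        using N.add_mem[OF cyN, of x] step by (simp add: algN_def algB_def)
      have \<phi>': "const (\<phi> (bscale c y + x)) = const c * const (\<phi> y) + const (\<phi> x)"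
        using step by (simp add: \<phi>_add[OF cyN] \<phi>_scale[OF yN] const_add const_mult)
      \<comment> \<open>The first two terms expand the generator linearly; the third is the basis
        case for \<open>y\<close>, the fourth the induction hypothesis for \<open>x\<close>.\<close>
      have "(gen (bscale c y + x) - (gen (bscale c y) + gen x)) * v + (gen (bscale c y) - const c * gen y) * v
         + const c * ((gen y - const (\<phi> y)) * v) + (gen x - const (\<phi> x)) * v \<in> K"
        using K.mult_mem[OF *[OF y(2)]] step unfolding y(1)
        by (intro K.add_mem K.gen_add_mem K.gen_scale_mem) blast+
      then have "(gen (bscale c y + x) - const (\<phi> (bscale c y + x))) * v \<in> K"
        unfolding \<phi>' by (simp add: algebra_simps)
      with sN show ?case by blast
    qed
    then show ?thesis ..
  qed
  then have "\<pi> (gen x * v) = \<pi> (const (\<phi> x) * v)" if "x \<in> carrier algN" for x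
    using that by (simp add: eq_iff K_def left_diff_distrib)
  then have "whittaker_vector algN \<phi> (modV \<phi> I) (\<pi> v)"
    using closed by (simp add: whittaker_vector_def act scale) (simp add: modV lie_mod_of_uea_def)
  with v show ?thesis by (auto simp: K_def zeroV)
qed

end
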